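(* Let $\mathbb K$ be a field of characteristic zero and let $\overline T(\mathcal{NC})$ be the unital tensor algebra over the linear span $\mathcal{NC}$ of all non-crossing partitions, with concatenation product. Equipped with the coproduct $\Delta$ described in the context, $\overline T(\mathcal{NC})$ is a connected graded, noncommutative and noncocommutative Hopf algebra.
   Context: For $n\ge 1$ let $[n]=\{1,\dots,n\}$. A partition of a finite set $S\subset\mathbb N$ into nonempty pairwise disjoint blocks is non-crossing if there are no $p_1<q_1<p_2<q_2$ in $S$ such that $p_1,p_2$ lie in one block and $q_1,q_2$ lie in a different block. $NC_n$ denotes the set of non-crossing partitions of $[n]$, and $\mathcal{NC}$ the $\mathbb K$-vector space with basis $\bigcup_{n\ge1}NC_n$; an element of $NC_n$ has degree $n$. For blocks $B,C$ of a non-crossing partition $L$, write $B<_L C$ iff $\inf C<m<\sup C$ for all $m\in B$ (i.e. $B$ is nested inside $C$). A decomposition $L=Q\sqcup U$ of the set of blocks of $L$ into two (possibly empty) subsets is called admissible if there is no block $B\in Q$ and block $C\in U$ with $B<_L C$. Given such an admissible decomposition of $L\in NC_n$, let $J_1,\dots,J_k$ be the maximal sets of consecutive integers contained in $[n]\setminus\bigcup_{B\in Q}B$, ordered from left to right; every block of $U$ is contained in a single $J_i$, and $J_i^{L,Q}$ denotes the non-crossing partition of $J_i$ formed by the blocks of $U$ contained in $J_i$. For a finite set $S\subset\mathbb N$ of cardinality $m$, the standardization $st$ is the unique increasing bijection $S\to[m]$; it is applied to partitions of $S$ by transporting blocks (so $st(Q)$ is a non-crossing partition of $[\,|\bigcup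 Q|\,]$). The unital tensor algebra $\overline T(\mathcal{NC})=\bigoplus_{k\ge0}\mathcal{NC}^{\otimes k}$ has elements written $L_1|\cdots|L_k$, product given by concatenation of such bar words, unit $\mathbf 1$ (the empty word), and grading by the sum of the degrees of the $L_i$. The coproduct is defined on $L\in NC_n$ by $$\Delta(L)=\sum_{L=Q\sqcup U\ \text{admissible}} st(Q)\otimes\big(st(J_1^{L,Q})|\cdots|st(J_k^{L,Q})\big),$$ with the conventions that $st(\emptyset)=\mathbf 1$ and that the empty bar word is $\mathbf 1$ (so $Q=\emptyset$ contributes $\mathbf 1\otimes L$ and $Q=L$ contributes $L\otimes\mathbf 1$); it is extended multiplicatively by $\Delta(L_1|\cdots|L_m)=\Delta(L_1)\cdots\Delta(L_m)$ (product in the tensor product algebra $\overline T(\mathcal{NC})\otimes\overline T(\mathcal{NC})$) and $\Delta(\mathbf 1)=\mathbf 1\otimes\mathbf 1$. *)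

theory Defs
  imports
    Complex_Main
    "HOL-Library.Poly_Mapping"
    "HOL-Library.Disjoint_Sets"
begin

section \<open>Vector spaces with a basis and their tensor products\<close>

text \<open>
  A vector space with basis \<open>'a\<close> is the type \<open>'a \<Rightarrow>\<^sub>0 'k\<close> of finitely supported functions; the
  basis vector of \<open>a\<close> is \<open>single a 1\<close>. The tensor product of the spaces with bases
  \<open>'a\<close> and \<open>'b\<close> is the space with basis \<open>'a \<times> 'b\<close>; its universal property is
  \<open>tensor_universal\<close> below.
\<close>

abbreviation keys :: "('a \<Rightarrow>\<^sub>0 'k::zero) \<Rightarrow> 'a set" where "keys \<equiv> Poly_Mapping.keys"
abbreviation lookup :: "('a \<Rightarrow>\<^sub>0 'k::zero) \<Rightarrow> 'a \<Rightarrow> 'k" where "lookup \<equiv> Poly_Mapping.lookup"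
abbreviation single :: "'a \<Rightarrow> 'k \<Rightarrow> ('a \<Rightarrow>\<^sub>0 'k::zero)" where "single \<equiv> Poly_Mapping.single"

definition fscale :: "'k::field \<Rightarrow> ('a \<Rightarrow>\<^sub>0 'k) \<Rightarrow> ('a \<Rightarrow>\<^sub>0 'k)" where
  "fscale c x = Poly_Mapping.map ((*) c) x"

lemma lookup_fscale [simp]: "lookup (fscale c x) a = c * lookup x a"
  by (simp add: fscale_def Poly_Mapping.map.rep_eq when_def)

global_interpretation pm: vector_space fscale
  by unfold_locales (auto intro!: poly_mapping_eqI simp: lookup_add algebra_simps)

abbreviation flinear :: "(('a \<Rightarrow>\<^sub>0 'k::field) \<Rightarrow> ('b \<Rightarrow>\<^sub>0 'k)) \<Rightarrow> bool" where
  "flinear \<equiv> Vector_Spaces.linear fscale fscale"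

lemma flinearI:
  assumes "\<And>x y. f (x + y) = f x + f y" "\<And>c x. f (fscale c x) = fscale c (f x)"
  shows "flinear f"
  by unfold_locales (use assms in auto)

definition lin_ext :: "('a \<Rightarrow> ('b \<Rightarrow>\<^sub>0 'k::field)) \<Rightarrow> ('a \<Rightarrow>\<^sub>0 'k) \<Rightarrow> ('b \<Rightarrow>\<^sub>0 'k)" where
  "lin_ext f x = (\<Sum>a\<in>keys x. fscale (lookup x a) (f a))"

lemma lin_ext_superset:
  assumes "finite A" "keys x \<subseteq> A"
  shows "lin_ext f x = (\<Sum>a\<in>A. fscale (lookup x a) (f a))"
  unfolding lin_ext_def
  by (rule sum.mono_neutral_left) (use assms in \<open>auto simp: in_keys_iff\<close>)

lemma lin_ext_single [simp]: "lin_ext f (single a 1) = f a"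
  by (simp add: lin_ext_def)

lemma linear_lin_ext:
  fixes f :: "'a \<Rightarrow> ('b \<Rightarrow>\<^sub>0 'k::field)"
  shows "flinear (lin_ext f)"
proof (rule flinearI)
  fix x y :: "'a \<Rightarrow>\<^sub>0 'k"
  let ?A = "keys x \<union> keys y"
  have "lin_ext f (x + y) = (\<Sum>a\<in>?A. fscale (lookup (x + y) a) (f a))"
    by (rule lin_ext_superset) (simp_all add: keys_add)
  also have "\<dots> = (\<Sum>a\<in>?A. fscale (lookup x a) (f a)) + (\<Sum>a\<in>?A. fscale (lookup y a) (f a))"
    by (simp add: lookup_add pm.scale_left_distrib sum.distrib)
  also have "(\<Sum>a\<in>?A. fscale (lookup x a) (f a)) = lin_ext f x"
    by (rule lin_ext_superset [symmetric]) auto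
  also have "(\<Sum>a\<in>?A. fscale (lookup y a) (f a)) = lin_ext f y"
    by (rule lin_ext_superset [symmetric]) auto
  finally show "lin_ext f (x + y) = lin_ext f x + lin_ext f y" .
next
  fix c and x :: "'a \<Rightarrow>\<^sub>0 'k"
  have "lin_ext f (fscale c x) = (\<Sum>a\<in>keys x. fscale (lookup (fscale c x) a) (f a))"
    by (rule lin_ext_superset) (auto simp: in_keys_iff)
  then show "lin_ext f (fscale c x) = fscale c (lin_ext f x)"
    by (simp add: lin_ext_def pm.scale_sum_right)
qed

lemma lin_ext_self: "lin_ext (\<lambda>a. single a 1) x = x"
proof (rule poly_mapping_eqI)
  fix b
  have "lookup (lin_ext (\<lambda>a. single a 1) x) b =
      (\<Sum>a\<in>keys x. if b = a then lookup x a else 0)"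
    unfolding lin_ext_def lookup_sum
    by (rule sum.cong) (auto simp: lookup_single when_def)
  then show "lookup (lin_ext (\<lambda>a. single a 1) x) b = lookup x b"
    by (simp add: in_keys_iff)
qed

lemma linear_eq_lin_ext:
  assumes "flinear f"
  shows "f x = lin_ext (\<lambda>a. f (single a 1)) x"
proof -
  interpret f: Vector_Spaces.linear fscale fscale f by fact
  have "f x = f (lin_ext (\<lambda>a. single a 1) x)"
    by (simp add: lin_ext_self)
  then show ?thesis
    by (simp add: lin_ext_def f.sum f.scale)
qed

lemma linear_ext:
  assumes "flinear f" "flinear g" "\<And>a. f (single a 1) = g (single a 1)"
  shows "f = g"
proof
  fix x
  have "f x = lin_ext (\<lambda>a. f (single a 1)) x" by (rule linear_eq_lin_ext) fact
  also have "\<dots> = lin_ext (\<lambda>a. g (single a 1)) x" by (simp only: assms(3))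
  also have "\<dots> = g x" by (rule linear_eq_lin_ext [symmetric]) fact
  finally show "f x = g x" .
qed

definition tensor :: "('a \<Rightarrow>\<^sub>0 'k::field) \<Rightarrow> ('b \<Rightarrow>\<^sub>0 'k) \<Rightarrow> ('a \<times> 'b \<Rightarrow>\<^sub>0 'k)" (infixr \<open>\<otimes>\<^sub>t\<close> 75)
  where "x \<otimes>\<^sub>t y = (\<Sum>a\<in>keys x. \<Sum>b\<in>keys y. single (a, b) (lookup x a * lookup y b))"

lemma lookup_tensor [simp]: "lookup (x \<otimes>\<^sub>t y) (a, b) = lookup x a * lookup y b"
proof -
  have "lookup (x \<otimes>\<^sub>t y) (a, b) =
      (\<Sum>a'\<in>keys x. if a = a' then \<Sum>b'\<in>keys y. if b = b' then lookup x a' * lookup y b' else 0 else 0)"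
    unfolding tensor_def lookup_sum
    by (intro sum.cong refl) (auto simp: lookup_single when_def intro!: sum.cong)
  then show ?thesis
    by (auto simp: in_keys_iff)
qed

lemma tensor_single [simp]: "single a c \<otimes>\<^sub>t single b d = single (a, b) (c * d)"
  by (rule poly_mapping_eqI) (auto simp: lookup_single when_def split: if_splits)

lemma linear_tensor_left: "flinear (\<lambda>x. x \<otimes>\<^sub>t y)"
  by (rule flinearI; rule poly_mapping_eqI) (auto simp: lookup_add algebra_simps)

lemma linear_tensor_right: "flinear (\<lambda>y. x \<otimes>\<^sub>t y)"
  by (rule flinearI; rule poly_mapping_eqI) (auto simp: lookup_add algebra_simps)

lemma bilinear_ext:
  assumes "\<And>y. flinear (\<lambda>x. f x y)" "\<And>x. flinear (f x)"
    and "\<And>y. flinear (\<lambda>x. g x y)" "\<And>x. flinear (g x)"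
    and "\<And>a b. f (single a 1) (single b 1) = g (single a 1) (single b 1)"
  shows "f x y = g x y"
proof -
  have "f (single a 1) = g (single a 1)" for a
    by (rule linear_ext) (use assms in auto)
  then have "(\<lambda>x. f x y) = (\<lambda>x. g x y)"
    by (intro linear_ext) (use assms in auto)
  then show ?thesis by meson
qed

lemma flinear_comp:
  assumes "flinear f" "flinear g"
  shows "flinear (\<lambda>x. g (f x))"
  using Vector_Spaces.linear_compose [OF assms] by (simp add: comp_def)

lemma tensor_universal:
  fixes h :: "('a \<Rightarrow>\<^sub>0 'k::field) \<Rightarrow> ('b \<Rightarrow>\<^sub>0 'k) \<Rightarrow> ('c \<Rightarrow>\<^sub>0 'k)"
  assumes "\<And>y. flinear (\<lambda>x. h x y)" "\<And>x. flinear (h x)"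
  shows "\<exists>!g. flinear g \<and> (\<forall>x y. g (x \<otimes>\<^sub>t y) = h x y)"
proof (rule ex1I)
  let ?g = "lin_ext (\<lambda>(a, b). h (single a 1) (single b 1))"
  have "?g (x \<otimes>\<^sub>t y) = h x y" for x y
    by (rule bilinear_ext)
      (use assms in \<open>auto intro: flinear_comp [OF linear_tensor_left linear_lin_ext]
        flinear_comp [OF linear_tensor_right linear_lin_ext]\<close>)
  then show "flinear ?g \<and> (\<forall>x y. ?g (x \<otimes>\<^sub>t y) = h x y)"
    by (simp add: linear_lin_ext)
next
  fix g
  assume g: "flinear g \<and> (\<forall>x y. g (x \<otimes>\<^sub>t y) = h x y)"
  show "g = lin_ext (\<lambda>(a, b). h (single a 1) (single b 1))"
  proof (rule linear_ext)
    fix p :: "'a \<times> 'b"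
    obtain a b where p: "p = (a, b)" by (cases p)
    have "g (single p 1) = g (single a 1 \<otimes>\<^sub>t single b 1)" by (simp add: p)
    also have "\<dots> = h (single a 1) (single b 1)" using g by blast
    finally show "g (single p 1) = lin_ext (\<lambda>(a, b). h (single a 1) (single b 1)) (single p 1)"
      by (simp add: p)
  qed (use g linear_lin_ext in auto)
qed

text \<open>The linear map \<open>f \<otimes> g\<close>, for linear \<open>f\<close> and \<open>g\<close>.\<close>

definition tensor_map ::
    "(('a \<Rightarrow>\<^sub>0 'k::field) \<Rightarrow> ('c \<Rightarrow>\<^sub>0 'k)) \<Rightarrow> (('b \<Rightarrow>\<^sub>0 'k) \<Rightarrow> ('d \<Rightarrow>\<^sub>0 'k)) \<Rightarrow>
      ('a \<times> 'b \<Rightarrow>\<^sub>0 'k) \<Rightarrow> ('c \<times> 'd \<Rightarrow>\<^sub>0 'k)" where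
  "tensor_map f g = lin_ext (\<lambda>(a, b). f (single a 1) \<otimes>\<^sub>t g (single b 1))"

lemma tensor_map_tensor:
  assumes "flinear f" "flinear g"
  shows "tensor_map f g (x \<otimes>\<^sub>t y) = f x \<otimes>\<^sub>t g y"
  unfolding tensor_map_def
  by (rule bilinear_ext)
    (auto intro: flinear_comp [OF linear_tensor_left linear_lin_ext]
        flinear_comp [OF linear_tensor_right linear_lin_ext]
        flinear_comp [OF assms(1) linear_tensor_left] flinear_comp [OF assms(2) linear_tensor_right])

definition tensor_assoc :: "(('a \<times> 'b) \<times> 'c \<Rightarrow>\<^sub>0 'k::field) \<Rightarrow> ('a \<times> 'b \<times> 'c \<Rightarrow>\<^sub>0 'k)" where
  "tensor_assoc = lin_ext (\<lambda>((a, b), c). single (a, b, c) 1)"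

definition tensor_swap :: "('a \<times> 'b \<Rightarrow>\<^sub>0 'k::field) \<Rightarrow> ('b \<times> 'a \<Rightarrow>\<^sub>0 'k)" where
  "tensor_swap = lin_ext (\<lambda>(a, b). single (b, a) 1)"

text \<open>
  For a bilinear product \<open>mult\<close>, \<open>tensor_fold mult\<close> is the induced linear map \<open>x \<otimes> y \<mapsto> xy\<close> and
  \<open>tensor_mult mult\<close> the product \<open>(x \<otimes> y)(x' \<otimes> y') = xx' \<otimes> yy'\<close>.
\<close>

definition tensor_fold ::
    "(('a \<Rightarrow>\<^sub>0 'k::field) \<Rightarrow> ('b \<Rightarrow>\<^sub>0 'k) \<Rightarrow> ('c \<Rightarrow>\<^sub>0 'k)) \<Rightarrow> ('a \<times> 'b \<Rightarrow>\<^sub>0 'k) \<Rightarrow> ('c \<Rightarrow>\<^sub>0 'k)" where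
  "tensor_fold mult = lin_ext (\<lambda>(a, b). mult (single a 1) (single b 1))"

definition tensor_mult ::
    "(('a \<Rightarrow>\<^sub>0 'k::field) \<Rightarrow> ('a \<Rightarrow>\<^sub>0 'k) \<Rightarrow> ('a \<Rightarrow>\<^sub>0 'k)) \<Rightarrow>
      ('a \<times> 'a \<Rightarrow>\<^sub>0 'k) \<Rightarrow> ('a \<times> 'a \<Rightarrow>\<^sub>0 'k) \<Rightarrow> ('a \<times> 'a \<Rightarrow>\<^sub>0 'k)" where
  "tensor_mult mult X Y =
    lin_ext (\<lambda>((a, b), (c, d)). mult (single a 1) (single c 1) \<otimes>\<^sub>t mult (single b 1) (single d 1))
      (X \<otimes>\<^sub>t Y)"

lemma tensor_mult_tensor:
  assumes "\<And>y. flinear (\<lambda>x. mult x y)" "\<And>x. flinear (mult x)"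
  shows "tensor_mult mult (x \<otimes>\<^sub>t y) (x' \<otimes>\<^sub>t y') = mult x x' \<otimes>\<^sub>t mult y y'"
proof -
  note lin = linear_lin_ext linear_tensor_left linear_tensor_right assms
  have right: "tensor_mult mult (single a 1 \<otimes>\<^sub>t single b 1) (x' \<otimes>\<^sub>t y') =
      mult (single a 1) x' \<otimes>\<^sub>t mult (single b 1) y'" for a b x' y'
    unfolding tensor_mult_def
    by (rule bilinear_ext)
      (auto intro: lin flinear_comp [OF flinear_comp [OF linear_tensor_left linear_tensor_right] linear_lin_ext]
        flinear_comp [OF flinear_comp [OF linear_tensor_right linear_tensor_right] linear_lin_ext]
        flinear_comp [OF assms(2) linear_tensor_left] flinear_comp [OF assms(2) linear_tensor_right]
        simp del: tensor_single simp: tensor_single [where c = 1 and d = 1, simplified])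
  show ?thesis
    unfolding tensor_mult_def
    by (rule bilinear_ext)
      (use right in \<open>auto intro: lin
        flinear_comp [OF flinear_comp [OF linear_tensor_left linear_tensor_left] linear_lin_ext]
        flinear_comp [OF flinear_comp [OF linear_tensor_right linear_tensor_left] linear_lin_ext]
        flinear_comp [OF assms(1) linear_tensor_left] flinear_comp [OF assms(1) linear_tensor_right]
        simp: tensor_mult_def\<close>)
qed

section \<open>Hopf algebras\<close>

locale unital_algebra =
  fixes mult :: "('b \<Rightarrow>\<^sub>0 'k::field) \<Rightarrow> ('b \<Rightarrow>\<^sub>0 'k) \<Rightarrow> ('b \<Rightarrow>\<^sub>0 'k)"
    and one :: "'b \<Rightarrow>\<^sub>0 'k"
  assumes linear_mult_left: "flinear (\<lambda>x. mult x y)"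
    and linear_mult_right: "flinear (\<lambda>y. mult x y)"
    and mult_assoc: "mult (mult x y) z = mult x (mult y z)"
    and mult_one_left: "mult one x = x"
    and mult_one_right: "mult x one = x"

locale counital_coalgebra =
  fixes comult :: "('b \<Rightarrow>\<^sub>0 'k::field) \<Rightarrow> ('b \<times> 'b \<Rightarrow>\<^sub>0 'k)"
    and counit :: "('b \<Rightarrow>\<^sub>0 'k) \<Rightarrow> 'k"
  assumes linear_comult: "flinear comult"
    and linear_counit: "Vector_Spaces.linear fscale (*) counit"
    and coassoc: "tensor_assoc (tensor_map comult id (comult x)) = tensor_map id comult (comult x)"
    and counit_left: "lin_ext (\<lambda>(a, b). fscale (counit (single a 1)) (single b 1)) (comult x) = x"
    and counit_right: "lin_ext (\<lambda>(a, b). fscale (counit (single b 1)) (single a 1)) (comult x) = x"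

locale bialgebra =
  unital_algebra mult one + counital_coalgebra comult counit
  for mult :: "('b \<Rightarrow>\<^sub>0 'k::field) \<Rightarrow> ('b \<Rightarrow>\<^sub>0 'k) \<Rightarrow> ('b \<Rightarrow>\<^sub>0 'k)"
    and one comult counit +
  assumes comult_one: "comult one = one \<otimes>\<^sub>t one"
    and comult_mult: "comult (mult x y) = tensor_mult mult (comult x) (comult y)"
    and counit_one: "counit one = 1"
    and counit_mult: "counit (mult x y) = counit x * counit y"

locale hopf_algebra =
  bialgebra mult one comult counit
  for mult :: "('b \<Rightarrow>\<^sub>0 'k::field) \<Rightarrow> ('b \<Rightarrow>\<^sub>0 'k) \<Rightarrow> ('b \<Rightarrow>\<^sub>0 'k)"
    and one comult counit +
  fixes antipode :: "('b \<Rightarrow>\<^sub>0 'k) \<Rightarrow> ('b \<Rightarrow>\<^sub>0 'k)"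
  assumes linear_antipode: "flinear antipode"
    and antipode_left:
      "tensor_fold mult (tensor_map antipode id (comult x)) = fscale (counit x) one"
    and antipode_right:
      "tensor_fold mult (tensor_map id antipode (comult x)) = fscale (counit x) one"

locale graded_hopf_algebra =
  hopf_algebra mult one comult counit antipode
  for mult :: "('b \<Rightarrow>\<^sub>0 'k::field) \<Rightarrow> ('b \<Rightarrow>\<^sub>0 'k) \<Rightarrow> ('b \<Rightarrow>\<^sub>0 'k)"
    and one comult counit antipode +
  fixes component :: "nat \<Rightarrow> ('b \<Rightarrow>\<^sub>0 'k) set"
  assumes subspace_component: "pm.subspace (component n)"
    and direct_sum: "\<exists>!c. (\<forall>n. c n \<in> component n) \<and> finite {n. c n \<noteq> 0} \<and>
      x = (\<Sum>n | c n \<noteq> 0. c n)"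
    and one_component: "one \<in> component 0"
    and mult_component:
      "x \<in> component m \<Longrightarrow> y \<in> component n \<Longrightarrow> mult x y \<in> component (m + n)"
    and comult_component:
      "x \<in> component n \<Longrightarrow>
        comult x \<in> pm.span {y \<otimes>\<^sub>t z |y z i j. i + j = n \<and> y \<in> component i \<and> z \<in> component j}"
    and counit_component: "x \<in> component n \<Longrightarrow> n \<noteq> 0 \<Longrightarrow> counit x = 0"
    and antipode_component: "x \<in> component n \<Longrightarrow> antipode x \<in> component n"

locale connected_graded_hopf_algebra =
  graded_hopf_algebra mult one comult counit antipode component
  for mult :: "('b \<Rightarrow>\<^sub>0 'k::field) \<Rightarrow> ('b \<Rightarrow>\<^sub>0 'k) \<Rightarrow> ('b \<Rightarrow>\<^sub>0 'k)"
    and one comult counit antipode component +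
  assumes connected: "component 0 = pm.span {one}"

definition commutative_algebra ::
    "(('b \<Rightarrow>\<^sub>0 'k::field) \<Rightarrow> ('b \<Rightarrow>\<^sub>0 'k) \<Rightarrow> ('b \<Rightarrow>\<^sub>0 'k)) \<Rightarrow> bool" where
  "commutative_algebra mult \<longleftrightarrow> (\<forall>x y. mult x y = mult y x)"

definition cocommutative_coalgebra ::
    "(('b \<Rightarrow>\<^sub>0 'k::field) \<Rightarrow> ('b \<times> 'b \<Rightarrow>\<^sub>0 'k)) \<Rightarrow> bool" where
  "cocommutative_coalgebra comult \<longleftrightarrow> (\<forall>x. tensor_swap (comult x) = comult x)"

section \<open>Non-crossing partitions\<close>

definition noncrossing :: "nat set set \<Rightarrow> bool" where
  "noncrossing P \<longleftrightarrow>
    \<not> (\<exists>B\<in>P. \<exists>C\<in>P. B \<noteq> C \<and>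
      (\<exists>p\<^sub>1 q\<^sub>1 p\<^sub>2 q\<^sub>2. p\<^sub>1 < q\<^sub>1 \<and> q\<^sub>1 < p\<^sub>2 \<and> p\<^sub>2 < q\<^sub>2 \<and> p\<^sub>1 \<in> B \<and> p\<^sub>2 \<in> B \<and> q\<^sub>1 \<in> C \<and> q\<^sub>2 \<in> C))"

definition NC :: "nat \<Rightarrow> nat set set set" where
  "NC n = {P. partition_on {1..n} P \<and> noncrossing P}"

typedef ncp = "\<Union>n\<in>{1..}. NC n"
proof
  show "{{1}} \<in> (\<Union>n\<in>{1..}. NC n)"
    by (intro UN_I [of 1]) (auto simp: NC_def noncrossing_def partition_on_def)
qed

definition nested :: "nat set \<Rightarrow> nat set \<Rightarrow> bool" where
  "nested B C \<longleftrightarrow> (\<forall>m\<in>B. Inf C < m \<and> m < Sup C)"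

text \<open>\<open>admissible L Q\<close> means that \<open>L = Q \<squnion> (L - Q)\<close> is an admissible decomposition.\<close>

definition admissible :: "nat set set \<Rightarrow> nat set set \<Rightarrow> bool" where
  "admissible L Q \<longleftrightarrow> Q \<subseteq> L \<and> \<not> (\<exists>B\<in>Q. \<exists>C\<in>L - Q. nested B C)"

text \<open>The increasing bijection from a finite set \<open>S\<close> onto \<open>{1..card S}\<close>.\<close>

definition st :: "nat set \<Rightarrow> nat \<Rightarrow> nat" where
  "st S x = card {y\<in>S. y \<le> x}"

definition st_partition :: "nat set set \<Rightarrow> nat set set" where
  "st_partition P = (\<lambda>B. st (\<Union>P) ` B) ` P"

definition consecutive :: "nat set \<Rightarrow> bool" where
  "consecutive J \<longleftrightarrow> (\<exists>a b. a \<le> b \<and> J = {a..b})"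

definition runs :: "nat set \<Rightarrow> nat set set" where
  "runs A = {J. consecutive J \<and> J \<subseteq> A \<and>
    (\<forall>J'. consecutive J' \<and> J' \<subseteq> A \<and> J \<subseteq> J' \<longrightarrow> J' = J)}"

definition run_list :: "nat set \<Rightarrow> nat set list" where
  "run_list A =
    (THE Js. set Js = runs A \<and> sorted_wrt (\<lambda>I J. \<forall>i\<in>I. \<forall>j\<in>J. i < j) Js)"

lemma strict_mono_on_st: "finite S \<Longrightarrow> strict_mono_on S (st S)"
proof (rule strict_mono_onI)
  fix r s assume *: "finite S" "r \<in> S" "s \<in> S" "r < s"
  then have "{y\<in>S. y \<le> r} \<subseteq> {y\<in>S. y \<le> s}" "s \<in> {y\<in>S. y \<le> s}" "s \<notin> {y\<in>S. y \<le> r}"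
    by auto
  then have "{y\<in>S. y \<le> r} \<subset> {y\<in>S. y \<le> s}" by blast
  then show "st S r < st S s" unfolding st_def by (rule psubset_card_mono [rotated]) (use * in auto)
qed

lemma bij_betw_st:
  assumes "finite S"
  shows "bij_betw (st S) S {1..card S}"
proof -
  have inj: "inj_on (st S) S"
    using strict_mono_on_st [OF assms] by (rule strict_mono_on_imp_inj_on)
  have "st S ` S \<subseteq> {1..card S}"
  proof clarsimp
    fix x assume x: "x \<in> S"
    have "card {x} \<le> st S x" "st S x \<le> card S"
      unfolding st_def by (rule card_mono; use assms x in auto)+
    then show "Suc 0 \<le> st S x \<and> st S x \<le> card S" by simp
  qed
  then have "st S ` S = {1..card S}"
    by (rule card_subset_eq [rotated]) (simp_all add: card_image inj)
  with inj show ?thesis by (simp add: bij_betw_def)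
qed

lemma st_unique:
  assumes "finite S" "strict_mono_on S f" "bij_betw f S {1..card S}" "x \<in> S"
  shows "f x = st S x"
proof -
  have "f ` {y\<in>S. y \<le> x} = {1..f x}"
  proof
    show "f ` {y\<in>S. y \<le> x} \<subseteq> {1..f x}"
    proof clarify
      fix y assume y: "y \<in> S" "y \<le> x"
      then have "f y \<in> {1..card S}" using assms(3) by (auto simp: bij_betw_def)
      moreover have "f y \<le> f x" using strict_mono_on_leD [OF assms(2) y(1) assms(4) y(2)] .
      ultimately show "f y \<in> {1..f x}" by simp
    qed
    show "{1..f x} \<subseteq> f ` {y\<in>S. y \<le> x}"
    proof
      fix k assume k: "k \<in> {1..f x}"
      moreover have "f x \<le> card S" using assms(3,4) by (auto simp: bij_betw_def)
      ultimately have "k \<in> f ` S" using assms(3) by (auto simp: bij_betw_def)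
      then obtain y where y: "y \<in> S" "k = f y" by blast
      have "y \<le> x"
        using k y assms(2,4) strict_mono_onD [OF assms(2), of x y] by (auto simp: not_le [symmetric])
      then show "k \<in> f ` {y\<in>S. y \<le> x}" using y by blast
    qed
  qed
  moreover have "inj_on f {y\<in>S. y \<le> x}"
    using assms(3) by (auto simp: bij_betw_def inj_on_def)
  ultimately show ?thesis
    unfolding st_def by (metis card_atLeastAtMost card_image diff_Suc_1)
qed

lemma noncrossingD:
  assumes "noncrossing P" "B \<in> P" "C \<in> P" "B \<noteq> C"
    and "p < q" "q < r" "r < s" "p \<in> B" "r \<in> B" "q \<in> C" "s \<in> C"
  shows False
proof -
  have "\<exists>p q r s. p < q \<and> q < r \<and> r < s \<and> p \<in> B \<and> r \<in> B \<and> q \<in> C \<and> s \<in> C"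
    using assms(5-11) by blast
  moreover have "\<not> (\<exists>p q r s. p < q \<and> q < r \<and> r < s \<and> p \<in> B \<and> r \<in> B \<and> q \<in> C \<and> s \<in> C)"
    using assms(1) [unfolded noncrossing_def bex_simps, THEN bspec, OF assms(2), THEN bspec, OF assms(3)]
      assms(4) by simp
  ultimately show False by (rule notE [rotated])
qed

lemma st_partition_NC:
  assumes S: "finite S" "partition_on S P" "noncrossing P"
  shows "st_partition P \<in> NC (card S)"
proof -
  have U: "\<Union>P = S" using S(2) by (simp add: partition_on_def)
  have inj: "inj_on (st S) S" and im: "st S ` S = {1..card S}"
    using bij_betw_st [OF S(1)] by (auto simp: bij_betw_def)
  have less: "x < y" if "st S x < st S y" "x \<in> S" "y \<in> S" for x y
    using strict_mono_onD [OF strict_mono_on_st [OF S(1)], of y x] that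
    by (metis not_less_iff_gr_or_eq)
  have part: "partition_on {1..card S} (st_partition P)"
  proof -
    have "(`) (st S) ` P - {{}} = (`) (st S) ` P"
      using S(2) by (auto simp: partition_on_def)
    then show ?thesis
      using partition_on_inj_image [OF S(2) inj] by (simp add: st_partition_def U im)
  qed
  moreover have "noncrossing (st_partition P)"
    unfolding noncrossing_def
  proof (clarsimp simp: st_partition_def U)
    fix B C p1 q1 p2 q2
    assume BC: "B \<in> P" "C \<in> P" "st S ` B \<noteq> st S ` C"
      and m: "p1 \<in> B" "p2 \<in> B" "q1 \<in> C" "q2 \<in> C"
      and l: "st S p1 < st S q1" "st S q1 < st S p2" "st S p2 < st S q2"
    have "p1 \<in> S" "p2 \<in> S" "q1 \<in> S" "q2 \<in> S"
      using BC m U by auto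
    then have "p1 < q1" "q1 < p2" "p2 < q2"
      using l less by blast+
    moreover have "B \<noteq> C" using BC by auto
    ultimately show False
      using noncrossingD [OF S(3) BC(1,2)] m by blast
  qed
  ultimately show ?thesis by (simp add: NC_def)
qed

lemma Sup_nat_mem: "finite B \<Longrightarrow> B \<noteq> {} \<Longrightarrow> Sup B \<in> (B :: nat set)"
  by (simp add: Sup_nat_def)

lemma residual_partition:
  assumes L: "L \<in> NC n" and Q: "admissible L Q" and J: "J \<in> runs (\<Union>L - \<Union>Q)"
  shows "partition_on J {B\<in>L - Q. B \<subseteq> J}" and "noncrossing {B\<in>L - Q. B \<subseteq> J}"
proof -
  let ?A = "\<Union>L - \<Union>Q"
  have part: "partition_on {1..n} L" and nc: "noncrossing L"
    using L by (auto simp: NC_def)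
  have UL: "\<Union>L = {1..n}" and disj: "disjoint L" and ne: "{} \<notin> L"
    using part by (auto simp: partition_on_def)
  have QL: "Q \<subseteq> L" using Q by (simp add: admissible_def)
  have gap: "{x..y} \<subseteq> ?A" if "B \<in> L - Q" "x \<in> B" "y \<in> B" for B x y
  proof
    fix z assume z: "z \<in> {x..y}"
    have fin: "finite B" by (rule finite_subset [of _ "{1..n}"]) (use that(1) UL in auto)
    have BQ: "w \<notin> \<Union>Q" if "w \<in> B" for w
    proof
      assume "w \<in> \<Union>Q"
      then obtain D where "D \<in> Q" "w \<in> D" by blast
      moreover have "B \<inter> D = {}"
        by (rule disjointD [OF disj]) (use \<open>B \<in> L - Q\<close> \<open>D \<in> Q\<close> QL in auto)
      ultimately show False using \<open>w \<in> B\<close> by blast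
    qed
    have "x \<in> {1..n}" "y \<in> {1..n}" using that UL by auto
    then have zL: "z \<in> \<Union>L" using z UL by auto
    show "z \<in> ?A"
    proof (rule ccontr)
      assume "z \<notin> ?A"
      with zL obtain C where C: "C \<in> Q" "z \<in> C" by auto
      have "z \<noteq> x" "z \<noteq> y" using BQ that C by auto
      then have xy: "x < z" "z < y" using z by auto
      have I: "Inf B \<in> B" "Sup B \<in> B" using that fin by (auto intro: Inf_nat_def1 Sup_nat_mem)
      have lz: "Inf B < z" using xy that by (meson cInf_lower bdd_below_bot le_less_trans)
      have zl: "z < Sup B" using xy that fin by (meson cSup_upper bdd_above_finite less_le_trans)
      have BC: "B \<noteq> C" using that C by blast
      have CL: "C \<in> L" "B \<in> L" using C QL that by auto
      have "Inf B < m \<and> m < Sup B" if m: "m \<in> C" for m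
      proof -
        have "m \<noteq> Inf B" "m \<noteq> Sup B" using BQ [OF I(1)] BQ [OF I(2)] C m by auto
        moreover have "\<not> m < Inf B"
          using noncrossingD [OF nc CL BC [symmetric] _ lz zl m C(2) I] by blast
        moreover have "\<not> Sup B < m"
          using noncrossingD [OF nc CL(2,1) BC lz zl _ I C(2) m] by blast
        ultimately show ?thesis by linarith
      qed
      then have "nested C B" by (simp add: nested_def)
      then show False using Q C that by (auto simp: admissible_def)
    qed
  qed
  obtain a b where ab: "a \<le> b" "J = {a..b}" and JA: "J \<subseteq> ?A"
    and max: "\<And>J'. consecutive J' \<Longrightarrow> J' \<subseteq> ?A \<Longrightarrow> J \<subseteq> J' \<Longrightarrow> J' = J"
    using J by (auto simp: runs_def consecutive_def)
  have "J \<subseteq> \<Union>{B\<in>L - Q. B \<subseteq> J}"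
  proof
    fix x assume x: "x \<in> J"
    then obtain B where B: "B \<in> L - Q" "x \<in> B" using JA by auto
    have "y \<in> J" if y: "y \<in> B" for y
    proof -
      have "min a y \<le> max b y" using ab by auto
      then have "consecutive {min a y..max b y}" unfolding consecutive_def by blast
      moreover have "{min a y..max b y} \<subseteq> J \<union> {x..y} \<union> {y..x}" using ab x by auto
      then have "{min a y..max b y} \<subseteq> ?A" using gap [OF B y] gap [OF B(1) y B(2)] JA by blast
      moreover have "J \<subseteq> {min a y..max b y}" using ab by auto
      ultimately have "{min a y..max b y} = J" by (rule max)
      then show ?thesis by auto
    qed
    with B show "x \<in> \<Union>{B\<in>L - Q. B \<subseteq> J}" by blast
  qed
  then show "partition_on J {B\<in>L - Q. B \<subseteq> J}"
    using disj ne by (auto simp: partition_on_def disjoint_def)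
  show "noncrossing {B\<in>L - Q. B \<subseteq> J}"
    using nc by (simp add: noncrossing_def)
qed

lemma runs_eqI:
  assumes "J \<in> runs A" "J' \<in> runs A" "J \<inter> J' \<noteq> {}"
  shows "J = J'"
proof -
  obtain a b c d where *: "J = {a..b}" "J' = {c..d}" "a \<le> b" "c \<le> d" "J \<subseteq> A" "J' \<subseteq> A"
    using assms by (auto simp: runs_def consecutive_def)
  then have "J \<union> J' = {min a c..max b d}" using assms(3) by auto
  moreover have "min a c \<le> max b d" using * by auto
  ultimately have "consecutive (J \<union> J')" unfolding consecutive_def by blast
  moreover have "K = I" if "I \<in> runs A" "consecutive K" "K \<subseteq> A" "I \<subseteq> K" for I K
    using that by (simp add: runs_def)
  ultimately have "J \<union> J' = J" "J \<union> J' = J'"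
    using assms(1,2) * by simp_all
  then show ?thesis by simp
qed

lemma run_list_unique:
  assumes "finite A"
  shows "\<exists>!Js. set Js = runs A \<and> sorted_wrt (\<lambda>I J. \<forall>i\<in>I. \<forall>j\<in>J. i < j) Js"
proof -
  let ?R = "\<lambda>I J :: nat set. \<forall>i\<in>I. \<forall>j\<in>J. i < j"
  have run: "\<exists>a b. J = {a..b} \<and> a \<le> b \<and> Min J = a \<and> a \<in> J" if "J \<in> runs A" for J
  proof -
    obtain a b where "J = {a..b}" "a \<le> b" using \<open>J \<in> runs A\<close> by (auto simp: runs_def consecutive_def)
    moreover then have "Min J = a" by (auto intro!: Min_eqI)
    ultimately show ?thesis by auto
  qed
  have fin: "finite (runs A)"
    by (rule finite_subset [of _ "Pow A"]) (use assms in \<open>auto simp: runs_def\<close>)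
  have Min_mem: "Min K \<in> K" if "K \<in> runs A" for K
    using run [OF that] by metis
  have inj: "inj_on Min (runs A)"
  proof (rule inj_onI)
    fix I J assume IJ: "I \<in> runs A" "J \<in> runs A" "Min I = Min J"
    from Min_mem [OF IJ(1)] Min_mem [OF IJ(2)] have "Min I \<in> I \<inter> J" unfolding IJ(3) by blast
    then show "I = J" using runs_eqI [OF IJ(1,2)] by blast
  qed
  define g where "g = the_inv_into (runs A) Min"
  have g: "g (Min J) = J" if "J \<in> runs A" for J
    unfolding g_def using inj that by (rule the_inv_into_f_f)
  let ?M = "sorted_list_of_set (Min ` runs A)"
  have M: "set ?M = Min ` runs A" using fin by simp
  show ?thesis
  proof (rule ex1I [of _ "map g ?M"], rule conjI)
    show "set (map g ?M) = runs A"
      using M g by (simp add: image_image)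
    have lt: "?R I J" if IJ: "I \<in> runs A" "J \<in> runs A" and l: "Min I < Min J" for I J
    proof -
      obtain a b c d where *: "I = {a..b}" "Min I = a" "J = {c..d}" "Min J = c" "a \<le> b" "c \<le> d"
        using run [OF IJ(1)] run [OF IJ(2)] by blast
      have "I \<inter> J = {}" using runs_eqI [OF IJ] l by blast
      then have "\<not> c \<le> b" using l * by auto
      then show ?thesis using * by auto
    qed
    have "sorted_wrt (<) ?M" by simp
    then have "sorted_wrt (\<lambda>x y. ?R (g x) (g y)) ?M"
    proof (rule sorted_wrt_mono_rel [rotated])
      fix x y assume "x \<in> set ?M" "y \<in> set ?M" and l: "x < y"
      then obtain I J where "I \<in> runs A" "J \<in> runs A" "x = Min I" "y = Min J"
        unfolding M by blast
      then show "?R (g x) (g y)" using lt [of I J] l by (simp add: g)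
    qed
    then show "sorted_wrt ?R (map g ?M)"
      by (simp add: sorted_wrt_map)
  next
    fix Js assume Js: "set Js = runs A \<and> sorted_wrt ?R Js"
    have "sorted_wrt (\<lambda>I J. Min I < Min J) Js"
      by (rule sorted_wrt_mono_rel [of _ ?R]) (use Js Min_mem in auto)
    then have "sorted_wrt (<) (map Min Js)" by (simp add: sorted_wrt_map)
    then have "map Min Js = ?M"
      by (intro strict_sorted_equal) (use Js fin in simp_all)
    from this [symmetric] have "map g ?M = map (\<lambda>J. g (Min J)) Js" by (simp add: comp_def)
    also have "\<dots> = Js" by (rule map_idI) (use Js g in auto)
    finally show "Js = map g ?M" by simp
  qed
qed

section \<open>The tensor algebra on non-crossing partitions\<close>

text \<open>Basis of the tensor algebra: bar words \<open>L\<^sub>1|\<cdots>|L\<^sub>k\<close>, represented as lists.\<close>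

type_synonym 'k TNC = "ncp list \<Rightarrow>\<^sub>0 'k"

definition bar_one :: "'k::field TNC" where
  "bar_one = single [] 1"

definition bar_mult :: "'k::field TNC \<Rightarrow> 'k TNC \<Rightarrow> 'k TNC" where
  "bar_mult x y = lin_ext (\<lambda>(v, w). single (v @ w) 1) (x \<otimes>\<^sub>t y)"

definition nc_degree :: "ncp \<Rightarrow> nat" where
  "nc_degree L = (THE n. Rep_ncp L \<in> NC n)"

lemma nc_degree_eq: "Rep_ncp L \<in> NC n \<Longrightarrow> nc_degree L = n"
  unfolding nc_degree_def
proof (rule the_equality)
  have "card (\<Union>(Rep_ncp L)) = m" if "Rep_ncp L \<in> NC m" for m
    using that by (simp add: NC_def partition_on_def)
  then show "Rep_ncp L \<in> NC n \<Longrightarrow> Rep_ncp L \<in> NC m \<Longrightarrow> m = n" for m by metis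
qed

definition word_degree :: "ncp list \<Rightarrow> nat" where
  "word_degree w = sum_list (map nc_degree w)"

definition nc_component :: "nat \<Rightarrow> 'k::field TNC set" where
  "nc_component n = pm.span {single w 1 |w. word_degree w = n}"

definition st_word :: "nat set set \<Rightarrow> ncp list" where
  "st_word Q = (if Q = {} then [] else [Abs_ncp (st_partition Q)])"

definition residual_word :: "nat set set \<Rightarrow> nat set set \<Rightarrow> ncp list" where
  "residual_word L Q =
    map (\<lambda>J. Abs_ncp (st_partition {B\<in>L - Q. B \<subseteq> J})) (run_list (\<Union>L - \<Union>Q))"

definition nc_coproduct_basis :: "ncp \<Rightarrow> (ncp list \<times> ncp list \<Rightarrow>\<^sub>0 'k::field)" where
  "nc_coproduct_basis L =
    (\<Sum>Q | admissible (Rep_ncp L) Q.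
      single (st_word Q) 1 \<otimes>\<^sub>t single (residual_word (Rep_ncp L) Q) 1)"

definition nc_coproduct_word :: "ncp list \<Rightarrow> (ncp list \<times> ncp list \<Rightarrow>\<^sub>0 'k::field)" where
  "nc_coproduct_word w =
    foldr (\<lambda>L X. tensor_mult bar_mult (nc_coproduct_basis L) X) w (bar_one \<otimes>\<^sub>t bar_one)"

definition nc_coproduct :: "'k::field TNC \<Rightarrow> (ncp list \<times> ncp list \<Rightarrow>\<^sub>0 'k)" where
  "nc_coproduct = lin_ext nc_coproduct_word"

end

theory Submission
  imports Defs "HOL-Library.Product_Plus"
begin

text \<open>
  The coproduct is multiplicative, so coassociativity and the counit laws only have
  to be checked on a single non-crossing partition \<open>L\<close>. There both iterated coproducts are sums over
  chains \<open>Q' \<subseteq> Q \<subseteq> L\<close> of admissible subsets: the runs left by \<open>Q'\<close> are separated from each other by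
  elements of \<open>Q'\<close>, no block is nested in a block of a different run, and so choosing an admissible
  subset in every run separately is the same as choosing \<open>Q - Q'\<close>. The antipode exists because the
  bialgebra is graded and connected.
\<close>

subsection \<open>Linear algebra over a basis\<close>

text \<open>The delicate factor is the middle one. Coming from the left leg, it is what
  \<open>Q'\<close> leaves of st(Q), where standardization has closed the holes left by the blocks
  outside \<open>Q\<close>, so that distant points become neighbours. Coming from the right leg, it
  is a concatenation over the runs of [n] left by \<open>Q'\<close>, to which a run without chosen
  blocks contributes the empty word. Maximal sets of consecutive integers do not survive the passage
  from [n] to the union of \<open>Q\<close>. Cutting by the elements of \<open>Q'\<close> does: in
  the smaller ground set the pieces are the nonempty traces of the old ones. Hence coproducts are
  computed on partitions of finite sets of integers before any renumbering. Non-crossing and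
  admissibility together make every remaining block lie in one piece. Since the partition of the
  empty set is not a letter, only the empty word has degree zero, which gives connectedness and
  dictates the counit.\<close>

lemma flinear_add: "flinear f \<Longrightarrow> f (x + y) = f x + f y"
  by (rule module_hom.add [OF Vector_Spaces.linear.axioms(3)])

lemma flinear_scale: "flinear f \<Longrightarrow> f (fscale c x) = fscale c (f x)"
  by (rule module_hom.scale [OF Vector_Spaces.linear.axioms(3)])

lemma flinear_sum: "flinear f \<Longrightarrow> f (sum g A) = (\<Sum>a\<in>A. f (g a))"
  by (rule module_hom.sum [OF Vector_Spaces.linear.axioms(3)])

lemma flinear_diff: "flinear f \<Longrightarrow> f (x - y) = f x - f y"
  by (rule module_hom.diff [OF Vector_Spaces.linear.axioms(3)])

lemma flinear_zero: "flinear f \<Longrightarrow> f 0 = 0"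
  by (rule module_hom.zero [OF Vector_Spaces.linear.axioms(3)])

lemma flinear_id: "flinear id" "flinear (\<lambda>x. x)"
  by (auto intro: flinearI)

lemma flinear_lin_ext: "flinear h \<Longrightarrow> h (lin_ext f x) = lin_ext (\<lambda>a. h (f a)) x"
  by (simp add: lin_ext_def flinear_sum flinear_scale)

lemma lin_ext_cong: "(\<And>a. a \<in> keys x \<Longrightarrow> f a = g a) \<Longrightarrow> lin_ext f x = lin_ext g x"
  by (simp add: lin_ext_def)

lemma lin_ext_sum_fun: "lin_ext (\<lambda>a. \<Sum>k\<in>K. f k a) x = (\<Sum>k\<in>K. lin_ext (f k) x)"
  by (simp add: lin_ext_def pm.scale_sum_right) (rule sum.swap)

lemma lin_ext_diff_fun: "lin_ext (\<lambda>a. f a - g a) x = lin_ext f x - lin_ext g x"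
  by (simp add: lin_ext_def pm.scale_right_diff_distrib sum_subtractf)

lemma lin_ext_mem_subspace:
  assumes "pm.subspace V" "\<And>a. a \<in> keys x \<Longrightarrow> f a \<in> V"
  shows "lin_ext f x \<in> V"
  unfolding lin_ext_def
  by (intro pm.subspace_sum pm.subspace_scale assms)

lemma fscale_single [simp]: "fscale c (single a d) = single a (c * d)"
  by (rule poly_mapping_eqI) (auto simp: lookup_single when_def)

text \<open>Turns membership in a graded component into a condition on supports, the form in which
  degrees are tracked below.\<close>

lemma span_singles: "pm.span {single w 1 |w. P w} = {x :: 'a \<Rightarrow>\<^sub>0 'k::field. \<forall>w\<in>keys x. P w}"
proof (intro equalityI subsetI)
  have "pm.subspace {x :: 'a \<Rightarrow>\<^sub>0 'k. \<forall>w\<in>keys x. P w}"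
    unfolding pm.subspace_def by (fastforce simp: in_keys_iff lookup_add)
  moreover have "{single w 1 |w. P w} \<subseteq> {x :: 'a \<Rightarrow>\<^sub>0 'k. \<forall>w\<in>keys x. P w}" by auto
  ultimately show "x \<in> {x. \<forall>w\<in>keys x. P w}" if "x \<in> pm.span {single w 1 |w. P w}"
    for x :: "'a \<Rightarrow>\<^sub>0 'k"
    using that pm.span_minimal by blast
  show "x \<in> pm.span {single w 1 |w. P w}" if "x \<in> {x. \<forall>w\<in>keys x. P w}"
    for x :: "'a \<Rightarrow>\<^sub>0 'k"
  proof -
    have "lin_ext (\<lambda>w. single w 1) x \<in> pm.span {single w (1 :: 'k) |w. P w}"
      by (rule lin_ext_mem_subspace) (use that in \<open>auto intro: pm.span_base\<close>)
    then show ?thesis by (simp add: lin_ext_self)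
  qed
qed

text \<open>The component of degree \<open>n\<close> is the restriction of \<open>x\<close> to the
  basis elements of that degree. Uniqueness: the coefficient at \<open>w\<close> can only come from
  the component of degree \<open>deg w\<close>.\<close>

lemma graded_decomposition:
  fixes x :: "'a \<Rightarrow>\<^sub>0 'k::field" and deg :: "'a \<Rightarrow> nat"
  shows "\<exists>!c. (\<forall>n. c n \<in> pm.span {single w 1 |w. deg w = n}) \<and> finite {n. c n \<noteq> 0} \<and>
    x = (\<Sum>n | c n \<noteq> 0. c n)"
proof -
  define p where "p n = (\<Sum>w | w \<in> keys x \<and> deg w = n. single w (lookup x w))" for n
  have lp: "lookup (p n) w = (if deg w = n then lookup x w else 0)" for n w
  proof -
    have "lookup (p n) w = (\<Sum>v | v \<in> keys x \<and> deg v = n. if w = v then lookup x v else 0)"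
      unfolding p_def lookup_sum by (intro sum.cong refl) (auto simp: lookup_single when_def)
    also have "\<dots> = (if deg w = n then lookup x w else 0)"
      by (subst sum.delta') (auto simp: in_keys_iff)
    finally show ?thesis .
  qed
  have fin: "finite {n. p n \<noteq> 0}"
  proof (rule finite_subset [of _ "deg ` keys x"])
    show "{n. p n \<noteq> 0} \<subseteq> deg ` keys x"
      unfolding p_def by (force intro: sum.neutral)
  qed simp
  have char: "c = p" if c: "\<forall>n. c n \<in> pm.span {single w 1 |w. deg w = n}" "finite {n. c n \<noteq> 0}"
    "x = (\<Sum>n | c n \<noteq> 0. c n)" for c
  proof (intro ext poly_mapping_eqI)
    fix n w
    have z: "lookup (c m) w = 0" if "deg w \<noteq> m" for m
      using c(1) that unfolding span_singles by (force simp: in_keys_iff)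
    have "lookup x w = (\<Sum>m | c m \<noteq> 0. lookup (c m) w)"
      by (subst c(3)) (simp add: lookup_sum)
    also have "\<dots> = (\<Sum>m | c m \<noteq> 0. if m = deg w then lookup (c m) w else 0)"
      by (intro sum.cong refl) (use z in auto)
    also have "\<dots> = lookup (c (deg w)) w"
      using c(2) by (subst sum.delta) auto
    finally have "lookup x w = lookup (c (deg w)) w" .
    then show "lookup (c n) w = lookup (p n) w"
      unfolding lp using z by auto
  qed
  have "x = (\<Sum>n | p n \<noteq> 0. p n)"
  proof (rule poly_mapping_eqI)
    fix w
    have "lookup (\<Sum>n | p n \<noteq> 0. p n) w =
        (\<Sum>n | p n \<noteq> 0. if n = deg w then lookup x w else 0)"
      unfolding lookup_sum by (intro sum.cong refl) (auto simp: lp)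
    also have "\<dots> = lookup x w"
      using fin lp [of "deg w" w] by (subst sum.delta) auto
    finally show "lookup x w = lookup (\<Sum>n | p n \<noteq> 0. p n) w" ..
  qed
  moreover have "\<forall>n. p n \<in> pm.span {single w 1 |w. deg w = n}"
    unfolding span_singles by (auto simp: in_keys_iff lp split: if_splits)
  ultimately show ?thesis
    using fin char by (intro ex1I [of _ p]) blast+
qed

subsection \<open>Convolution and the antipode of a connected graded bialgebra\<close>

context bialgebra
begin

text \<open>Convolution: multiplication after \<open>f\<close> tensor \<open>g\<close> after the
  coproduct. Spelled out on basis pairs, it is linear in \<open>x\<close> for all \<open>f\<close>
  and \<open>g\<close>.\<close>

definition conv :: "(('b \<Rightarrow>\<^sub>0 'k) \<Rightarrow> ('b \<Rightarrow>\<^sub>0 'k)) \<Rightarrow> (('b \<Rightarrow>\<^sub>0 'k) \<Rightarrow> ('b \<Rightarrow>\<^sub>0 'k)) \<Rightarrow>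
    ('b \<Rightarrow>\<^sub>0 'k) \<Rightarrow> ('b \<Rightarrow>\<^sub>0 'k)" where
  "conv f g x = lin_ext (\<lambda>(a, b). mult (f (single a 1)) (g (single b 1))) (comult x)"

definition conv_unit :: "('b \<Rightarrow>\<^sub>0 'k) \<Rightarrow> ('b \<Rightarrow>\<^sub>0 'k)" where
  "conv_unit x = fscale (counit x) one"

lemma flinear_conv: "flinear (conv f g)"
  unfolding conv_def by (rule flinear_comp [OF linear_comult linear_lin_ext])

lemma flinear_conv_unit: "flinear conv_unit"
  unfolding conv_unit_def
  by (rule flinearI)
    (simp_all add: module_hom.add [OF Vector_Spaces.linear.axioms(3) [OF linear_counit]]
      module_hom.scale [OF Vector_Spaces.linear.axioms(3) [OF linear_counit]] pm.scale_left_distrib)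

lemma tensor_fold_tensor: "tensor_fold mult (x \<otimes>\<^sub>t y) = mult x y"
  unfolding tensor_fold_def
  by (rule bilinear_ext)
    (auto intro: flinear_comp [OF linear_tensor_left linear_lin_ext]
      flinear_comp [OF linear_tensor_right linear_lin_ext] linear_mult_left linear_mult_right)

text \<open>Reads the two antipode axioms as the statement that the antipode is a two-sided
  convolution inverse of \<open>id\<close>.\<close>

lemma tensor_fold_tensor_map_comult:
  "tensor_fold mult (tensor_map f g (comult x)) = conv f g x"
proof -
  have "flinear (tensor_fold mult)" unfolding tensor_fold_def by (rule linear_lin_ext)
  then show ?thesis
    unfolding tensor_map_def conv_def
    by (simp add: flinear_lin_ext split_def tensor_fold_tensor)
qed

text \<open>Both sides are the image, under the single linear map \<open>lin_ext T\<close> on triple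
  tensors, of one of the two iterated coproducts; these coincide by coassociativity.\<close>

lemma conv_assoc:
  assumes f: "flinear f" and g: "flinear g" and h: "flinear h"
  shows "conv (conv f g) h = conv f (conv g h)"
proof
  fix x
  define T where "T = (\<lambda>(a, b, c). mult (f (single a 1)) (mult (g (single b 1)) (h (single c 1))))"
  have T: "flinear (lin_ext T)" by (rule linear_lin_ext)
  have assoc: "flinear tensor_assoc" unfolding tensor_assoc_def by (rule linear_lin_ext)
  have assoc_single: "tensor_assoc (single ((a, b), c) 1) = single (a, b, c) (1 :: 'k)" for a b c :: 'b
    by (simp add: tensor_assoc_def)
  have T_single: "T (a, b, c) = mult (f (single a 1)) (mult (g (single b 1)) (h (single c 1)))" for a b c
    by (simp add: T_def)
  \<comment> \<open>Linearity in \<open>y\<close> reduces this to basis tensors, where associativity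
    of \<open>mult\<close> moves the brackets.\<close>
  have left_step: "lin_ext T (tensor_assoc (y \<otimes>\<^sub>t single c 1)) =
      mult (lin_ext (\<lambda>(a, b). mult (f (single a 1)) (g (single b 1))) y) (h (single c 1))" for y c
  proof -
    have "(\<lambda>y. lin_ext T (tensor_assoc (y \<otimes>\<^sub>t single c 1))) =
      (\<lambda>y. mult (lin_ext (\<lambda>(a, b). mult (f (single a 1)) (g (single b 1))) y) (h (single c 1)))"
      by (rule linear_ext)
        (auto intro: flinear_comp [OF linear_tensor_left flinear_comp [OF assoc T]]
          flinear_comp [OF linear_lin_ext linear_mult_left]
          simp: assoc_single T_single mult_assoc)
    then show ?thesis by meson
  qed
  have "lin_ext T (tensor_assoc (tensor_map comult id (comult x))) =
      lin_ext (\<lambda>(a, c). lin_ext T (tensor_assoc (comult (single a 1) \<otimes>\<^sub>t single c 1))) (comult x)"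
    unfolding tensor_map_def
    by (simp add: flinear_lin_ext [OF T] flinear_lin_ext [OF assoc] split_def)
  then have left: "lin_ext T (tensor_assoc (tensor_map comult id (comult x))) =
      conv (conv f g) h x"
    unfolding conv_def [of "conv f g"] by (simp add: conv_def left_step)
  have right_step: "lin_ext T (single a 1 \<otimes>\<^sub>t y) =
      mult (f (single a 1)) (lin_ext (\<lambda>(a, b). mult (g (single a 1)) (h (single b 1))) y)" for y a
  proof -
    have "(\<lambda>y. lin_ext T (single a 1 \<otimes>\<^sub>t y)) =
      (\<lambda>y. mult (f (single a 1)) (lin_ext (\<lambda>(a, b). mult (g (single a 1)) (h (single b 1))) y))"
      by (rule linear_ext)
        (auto intro: flinear_comp [OF linear_tensor_right T]
          flinear_comp [OF linear_lin_ext linear_mult_right]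
          simp: T_single)
    then show ?thesis by meson
  qed
  have "lin_ext T (tensor_map id comult (comult x)) =
      lin_ext (\<lambda>(a, c). lin_ext T (single a 1 \<otimes>\<^sub>t comult (single c 1))) (comult x)"
    unfolding tensor_map_def by (simp add: flinear_lin_ext [OF T] split_def)
  then have right: "lin_ext T (tensor_map id comult (comult x)) = conv f (conv g h) x"
    unfolding conv_def [of f] by (simp add: conv_def right_step)
  show "conv (conv f g) h x = conv f (conv g h) x"
    using left right coassoc by simp
qed

lemma conv_unit_left:
  assumes "flinear g"
  shows "conv conv_unit g x = g x"
proof -
  have "conv conv_unit g x = g (lin_ext (\<lambda>(a, b). fscale (counit (single a 1)) (single b 1)) (comult x))"
    unfolding conv_def conv_unit_def
    by (simp add: flinear_lin_ext [OF assms] split_def flinear_scale [OF assms]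
      flinear_scale [OF linear_mult_left] mult_one_left del: fscale_single)
  then show ?thesis by (simp only: counit_left)
qed

lemma conv_unit_right:
  assumes "flinear f"
  shows "conv f conv_unit x = f x"
proof -
  have "conv f conv_unit x = f (lin_ext (\<lambda>(a, b). fscale (counit (single b 1)) (single a 1)) (comult x))"
    unfolding conv_def conv_unit_def
    by (simp add: flinear_lin_ext [OF assms] split_def flinear_scale [OF assms]
      flinear_scale [OF linear_mult_right] mult_one_right del: fscale_single)
  then show ?thesis by (simp only: counit_right)
qed

lemma conv_sum_left: "conv (\<lambda>x. \<Sum>k\<in>K. f k x) g x = (\<Sum>k\<in>K. conv (f k) g x)"
  unfolding conv_def
  by (simp add: flinear_sum [OF linear_mult_left] split_def lin_ext_sum_fun)

lemma conv_sum_right: "conv f (\<lambda>x. \<Sum>k\<in>K. g k x) x = (\<Sum>k\<in>K. conv f (g k) x)"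
  unfolding conv_def
  by (simp add: flinear_sum [OF linear_mult_right] split_def lin_ext_sum_fun)

lemma conv_diff_left: "conv (\<lambda>x. f x - f' x) g x = conv f g x - conv f' g x"
  unfolding conv_def
  by (simp add: flinear_diff [OF linear_mult_left] split_def lin_ext_diff_fun)

lemma conv_diff_right: "conv f (\<lambda>x. g x - g' x) x = conv f g x - conv f g' x"
  unfolding conv_def
  by (simp add: flinear_diff [OF linear_mult_right] split_def lin_ext_diff_fun)

definition conv_power :: "(('b \<Rightarrow>\<^sub>0 'k) \<Rightarrow> ('b \<Rightarrow>\<^sub>0 'k)) \<Rightarrow> nat \<Rightarrow> ('b \<Rightarrow>\<^sub>0 'k) \<Rightarrow> ('b \<Rightarrow>\<^sub>0 'k)" where
  "conv_power f k = (conv f ^^ k) conv_unit"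

lemma conv_power_0: "conv_power f 0 = conv_unit"
  and conv_power_Suc: "conv_power f (Suc k) = conv f (conv_power f k)"
  by (simp_all add: conv_power_def)

lemma flinear_conv_power: "flinear (conv_power f k)"
  by (cases k) (simp_all add: conv_power_0 conv_power_Suc flinear_conv flinear_conv_unit)

text \<open>The same geometric series must invert \<open>id\<close> from both sides, so a factor has
  to be split off on the right as well as on the left.\<close>

lemma conv_power_Suc_right:
  assumes "flinear f"
  shows "conv_power f (Suc k) = conv (conv_power f k) f"
proof (induction k)
  case 0
  show ?case
    by (auto simp: conv_power_Suc conv_power_0 conv_unit_left conv_unit_right assms)
next
  case (Suc k)
  then show ?case
    by (metis assms conv_assoc conv_power_Suc flinear_conv_power)
qed

text \<open>
  The antipode is the Neumann series of \<open>id = u - p\<close>, where \<open>u\<close> is the unit of the convolution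
  product. The series is finite on each degree because \<open>p\<close> vanishes in degree \<open>0\<close>.
\<close>

theorem connected_graded_bialgebra_has_antipode:
  fixes deg :: "'b \<Rightarrow> nat"
  defines "H \<equiv> \<lambda>n. pm.span {single w 1 |w. deg w = n}"
  assumes one: "one = single e 1" and deg_0: "\<And>w. deg w = 0 \<longleftrightarrow> w = e"
    and deg_mult: "\<And>v w. mult (single v 1) (single w 1) \<in> H (deg v + deg w)"
    and deg_comult: "\<And>w a b. (a, b) \<in> keys (comult (single w 1)) \<Longrightarrow> deg a + deg b = deg w"
    and counit: "\<And>w. w \<noteq> e \<Longrightarrow> counit (single w 1) = 0"
  shows "\<exists>antipode. connected_graded_hopf_algebra mult one comult counit antipode H"
proof -
  have sub: "pm.subspace (H n)" for n
    unfolding H_def by (rule pm.subspace_span)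
  have H: "H n = {x. \<forall>w\<in>keys x. deg w = n}" for n
    unfolding H_def by (rule span_singles)
  \<comment> \<open>Every grading axiom is tested on basis elements of the given degree through this
    fact.\<close>
  have ext: "f x \<in> V" if "flinear f" "pm.subspace V" "x \<in> H n" "\<And>w. deg w = n \<Longrightarrow> f (single w 1) \<in> V"
    for n x V and f :: "('b \<Rightarrow>\<^sub>0 'k) \<Rightarrow> ('c \<Rightarrow>\<^sub>0 'k)"
    using that(3,4) by (subst linear_eq_lin_ext [OF that(1)])
      (auto simp: H intro: lin_ext_mem_subspace [OF that(2)])
  have mult_H: "mult x y \<in> H (m + n)" if "x \<in> H m" "y \<in> H n" for x y m n
  proof (rule ext [OF linear_mult_left sub that(1)])
    show "mult (single v 1) y \<in> H (m + n)" if "deg v = m" for v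
      by (rule ext [OF linear_mult_right sub \<open>y \<in> H n\<close>]) (use that deg_mult in auto)
  qed
  have conv_H: "conv f g (single w 1) \<in> H (deg w)"
    if "\<And>v. f (single v 1) \<in> H (deg v)" "\<And>v. g (single v 1) \<in> H (deg v)" for f g w
    unfolding conv_def
  proof (rule lin_ext_mem_subspace [OF sub], clarify)
    fix a b assume "(a, b) \<in> keys (comult (single w 1))"
    from deg_comult [OF this] show "mult (f (single a 1)) (g (single b 1)) \<in> H (deg w)"
      using mult_H [OF that] by metis
  qed
  have unit_H: "conv_unit (single w 1) \<in> H (deg w)" for w
    unfolding conv_unit_def
    by (cases "w = e") (auto simp: counit one H deg_0 [THEN iffD2] pm.subspace_0 [OF sub])
  define p where "p x = conv_unit x - x" for x
  have lin_p: "flinear p"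
    unfolding p_def
    by (rule flinearI)
      (simp_all add: flinear_add [OF flinear_conv_unit] flinear_scale [OF flinear_conv_unit]
        pm.scale_right_diff_distrib)
  have p_e: "p (single e 1) = 0"
    unfolding p_def conv_unit_def using counit_one one by simp
  have id_eq: "id = (\<lambda>x. conv_unit x - p x)"
    by (auto simp: p_def)
  have p_H: "p (single w 1) \<in> H (deg w)" for w
    unfolding p_def by (rule pm.subspace_diff [OF sub unit_H]) (simp add: H)
  have power_H: "conv_power p k (single w 1) \<in> H (deg w)" for k w
    by (induction k arbitrary: w) (auto simp: conv_power_0 conv_power_Suc unit_H intro!: conv_H p_H)
  \<comment> \<open>Each factor \<open>p\<close> uses up at least one degree: if the left leg is
    \<open>e\<close>, then \<open>p\<close> kills the term; otherwise the right leg has smaller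
    degree and the induction hypothesis applies.\<close>
  have vanish: "conv_power p k (single w 1) = 0" if "deg w < k" for k w
    using that
  proof (induction k arbitrary: w)
    case (Suc k)
    have "mult (p (single a 1)) (conv_power p k (single b 1)) = 0"
      if ab: "(a, b) \<in> keys (comult (single w 1))" for a b
    proof (cases "a = e")
      case True
      then show ?thesis by (simp add: p_e flinear_zero [OF linear_mult_left])
    next
      case False
      then have "deg b < k" using deg_comult [OF ab] deg_0 [of a] Suc.prems by auto
      then show ?thesis by (simp add: Suc.IH flinear_zero [OF linear_mult_right])
    qed
    then have "conv_power p (Suc k) (single w 1) = lin_ext (\<lambda>_. 0) (comult (single w 1))"
      unfolding conv_power_Suc conv_def by (intro lin_ext_cong) auto
    then show ?case by (simp add: lin_ext_def)
  qed simp
  define S where "S = lin_ext (\<lambda>w. \<Sum>k\<le>deg w. conv_power p k (single w 1))"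
  \<comment> \<open>The cut-off in \<open>S\<close> depends on the basis element, while
    \<open>N n\<close> is linear with a fixed cut-off. Both legs of the coproduct of
    \<open>w\<close> have degree at most \<open>deg w\<close>, so inside a convolution
    \<open>S\<close> may be replaced by \<open>N (deg w)\<close>, over whose terms convolution
    distributes.\<close>
  define N where "N n x = (\<Sum>k\<le>n. conv_power p k x)" for n :: nat and x
  have lin_N: "flinear (N n)" for n
    unfolding N_def
    by (rule flinearI)
      (simp_all add: flinear_add [OF flinear_conv_power] flinear_scale [OF flinear_conv_power]
        sum.distrib pm.scale_sum_right)
  have S_N: "S (single w 1) = N n (single w 1)" if "deg w \<le> n" for w n
    unfolding S_def N_def lin_ext_single
    by (rule sum.mono_neutral_left) (use that vanish in auto)
  \<comment> \<open>The difference is the power 0 minus the power \<open>n + 1\<close>, and the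
    latter vanishes in degree \<open>n\<close>.\<close>
  have telescope: "N n (single w 1) - (\<Sum>k\<le>n. conv_power p (Suc k) (single w 1)) =
      conv_unit (single w 1)" if "deg w = n" for n w
    unfolding N_def sum_subtractf [symmetric]
    using vanish [of w "Suc n"] that by (subst sum_telescope) (simp add: conv_power_0)
  have left: "conv S id = conv_unit"
  proof (rule linear_ext [OF flinear_conv flinear_conv_unit])
    fix w
    let ?n = "deg w"
    have "conv S id (single w 1) = conv (N ?n) id (single w 1)"
      unfolding conv_def
      by (rule lin_ext_cong) (auto dest!: deg_comult simp: S_N [of _ ?n])
    also have "\<dots> = N ?n (single w 1) - conv (N ?n) p (single w 1)"
      unfolding id_eq by (simp add: conv_diff_right conv_unit_right lin_N)
    also have "conv (N ?n) p (single w 1) = (\<Sum>k\<le>?n. conv_power p (Suc k) (single w 1))"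
      unfolding N_def by (simp add: conv_sum_left conv_power_Suc_right [OF lin_p])
    finally show "conv S id (single w 1) = conv_unit (single w 1)"
      unfolding telescope [OF refl] .
  qed
  have right: "conv id S = conv_unit"
  proof (rule linear_ext [OF flinear_conv flinear_conv_unit])
    fix w
    let ?n = "deg w"
    have "conv id S (single w 1) = conv id (N ?n) (single w 1)"
      unfolding conv_def
      by (rule lin_ext_cong) (auto dest!: deg_comult simp: S_N [of _ ?n])
    also have "\<dots> = N ?n (single w 1) - conv p (N ?n) (single w 1)"
      unfolding id_eq by (simp add: conv_diff_left conv_unit_left lin_N)
    also have "conv p (N ?n) (single w 1) = (\<Sum>k\<le>?n. conv_power p (Suc k) (single w 1))"
      unfolding N_def by (simp add: conv_sum_right conv_power_Suc)
    finally show "conv id S (single w 1) = conv_unit (single w 1)"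
      unfolding telescope [OF refl] .
  qed
  have lin_S: "flinear S"
    unfolding S_def by (rule linear_lin_ext)
  have "connected_graded_hopf_algebra mult one comult counit S H"
  proof (intro connected_graded_hopf_algebra.intro connected_graded_hopf_algebra_axioms.intro
      graded_hopf_algebra.intro graded_hopf_algebra_axioms.intro
      hopf_algebra.intro hopf_algebra_axioms.intro bialgebra_axioms)
    show "flinear S" by (rule lin_S)
    show "tensor_fold mult (tensor_map S id (comult x)) = fscale (counit x) one"
      "tensor_fold mult (tensor_map id S (comult x)) = fscale (counit x) one" for x
      by (simp_all add: tensor_fold_tensor_map_comult left right conv_unit_def)
    show "pm.subspace (H n)" for n by (rule sub)
    show "\<exists>!c. (\<forall>n. c n \<in> H n) \<and> finite {n. c n \<noteq> 0} \<and> x = (\<Sum>n | c n \<noteq> 0. c n)" for x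
      unfolding H_def by (rule graded_decomposition)
    show "one \<in> H 0" by (simp add: one H deg_0)
    show "mult x y \<in> H (m + n)" if "x \<in> H m" "y \<in> H n" for x y m n
      by (rule mult_H [OF that])
    show "comult x \<in> pm.span {y \<otimes>\<^sub>t z |y z i j. i + j = n \<and> y \<in> H i \<and> z \<in> H j}" (is "_ \<in> ?V")
      if "x \<in> H n" for x n
    proof (rule ext [OF linear_comult pm.subspace_span that])
      fix w assume w: "deg w = n"
      \<comment> \<open>The coproduct is rebuilt from the basis pairs in its support, each of which
        is a pure tensor of homogeneous elements.\<close>
      have "lin_ext (\<lambda>q. single q 1) (comult (single w 1)) \<in> ?V"
      proof (rule lin_ext_mem_subspace [OF pm.subspace_span])
        fix q assume "q \<in> keys (comult (single w 1))"
        then obtain a b where q: "q = (a, b)" "deg a + deg b = n"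
          using deg_comult w by (cases q) auto
        have "single q 1 = single a 1 \<otimes>\<^sub>t single b (1 :: 'k)" by (simp add: q)
        moreover have "single a 1 \<in> H (deg a)" "single b 1 \<in> H (deg b)" by (simp_all add: H)
        ultimately show "single q 1 \<in> ?V" using q(2) by (intro pm.span_base) blast
      qed
      then show "comult (single w 1) \<in> ?V" by (simp add: lin_ext_self)
    qed
    show "counit x = 0" if "x \<in> H n" "n \<noteq> 0" for x n
    proof -
      \<comment> \<open>The counit is scalar-valued, whereas \<open>ext\<close> speaks of maps
        between spaces with a basis; so \<open>conv_unit\<close> is used and its coefficient at
        \<open>e\<close> read off.\<close>
      have "conv_unit x \<in> {0}"
      proof (rule ext [OF flinear_conv_unit pm.subspace_single_0 that(1)])
        fix w assume "deg w = n"
        then have "w \<noteq> e" using that(2) deg_0 [of w] by auto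
        then show "conv_unit (single w 1) \<in> {0}" by (simp add: conv_unit_def counit)
      qed
      then have "lookup (conv_unit x) e = 0" by simp
      then show ?thesis unfolding conv_unit_def by (simp add: one)
    qed
    show "S x \<in> H n" if "x \<in> H n" for x n
      by (rule ext [OF lin_S sub that])
        (auto simp: S_def intro!: pm.subspace_sum sub power_H)
    show "H 0 = pm.span {one}"
      unfolding H_def one by (rule arg_cong [of _ _ pm.span]) (auto simp: deg_0)
  qed
  then show ?thesis by blast
qed

end

subsection \<open>Monoid algebras\<close>

text \<open>
  With concatenation as addition of words, the tensor algebra and its tensor powers are monoid
  algebras, and their products are the ring multiplication of finitely supported functions.
\<close>

instantiation list :: (type) monoid_add
begin

definition zero_list_def: "0 = []"

definition plus_list_def: "xs + ys = xs @ ys"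

instance by standard (simp_all add: zero_list_def plus_list_def)

end

text \<open>Scalars sit in the monoid algebra as multiples of the unit, so compatibility of products
  with scaling becomes associativity.\<close>

lemma fscale_eq_mult: "fscale c x = single 0 c * (x :: 'a::monoid_add \<Rightarrow>\<^sub>0 'k::field)"
proof -
  have "single 0 c * lin_ext (\<lambda>a. single a 1) x = fscale c (lin_ext (\<lambda>a. single a 1) x)"
    by (simp add: lin_ext_def sum_distrib_left pm.scale_sum_right mult_single)
  then show ?thesis by (simp add: lin_ext_self)
qed

lemma flinear_times_left: "flinear (\<lambda>x. x * (y :: 'a::monoid_add \<Rightarrow>\<^sub>0 'k::field))"
  by (rule flinearI) (simp_all add: fscale_eq_mult distrib_right mult.assoc)

lemma flinear_times_right: "flinear (\<lambda>y. (x :: 'a::monoid_add \<Rightarrow>\<^sub>0 'k::field) * y)"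
proof (rule flinearI)
  fix c :: 'k and y :: "'a \<Rightarrow>\<^sub>0 'k"
  \<comment> \<open>Scalars are central: on a basis element both sides carry the coefficient
    \<open>c\<close>, at the position \<open>a + 0 = a\<close>.\<close>
  have "(\<lambda>x. x * single 0 c) = fscale c"
    by (rule linear_ext)
      (auto intro: flinear_times_left flinearI simp: pm.scale_right_distrib mult_single mult.commute)
  then have "x * single 0 c = fscale c x" for x :: "'a \<Rightarrow>\<^sub>0 'k" by (rule fun_cong)
  then show "x * fscale c y = fscale c (x * y)"
    by (metis fscale_eq_mult mult.assoc)
qed (simp add: distrib_left)

text \<open>Both sides are bilinear and basis elements multiply by adding their indices, so
  multiplicativity is a statement about basis elements.\<close>

lemma flinear_multiplicativeI:
  fixes f :: "('a::monoid_add \<Rightarrow>\<^sub>0 'k::field) \<Rightarrow> ('b::monoid_add \<Rightarrow>\<^sub>0 'k)"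
  assumes "flinear f" "\<And>a b. f (single (a + b) 1) = f (single a 1) * f (single b 1)"
  shows "f (x * y) = f x * f y"
  by (rule bilinear_ext)
    (auto intro: flinear_comp [OF flinear_times_left assms(1)] flinear_comp [OF assms(1) flinear_times_left]
      flinear_comp [OF flinear_times_right assms(1)] flinear_comp [OF assms(1) flinear_times_right]
      simp: mult_single assms(2))

text \<open>The tensor square of a monoid algebra is the monoid algebra of the product monoid, with
  componentwise addition on pairs.\<close>

lemma tensor_mult_times:
  "tensor_mult (*) X Y = X * (Y :: 'a::monoid_add \<times> 'a \<Rightarrow>\<^sub>0 'k::field)"
  unfolding tensor_mult_def
  by (rule bilinear_ext)
    (auto intro: flinear_comp [OF linear_tensor_left linear_lin_ext]
      flinear_comp [OF linear_tensor_right linear_lin_ext] flinear_times_left flinear_times_right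
      simp: mult_single)

lemma tensor_times:
  fixes x x' :: "'a::monoid_add \<Rightarrow>\<^sub>0 'k::field" and y y' :: "'b::monoid_add \<Rightarrow>\<^sub>0 'k"
  shows "(x * x') \<otimes>\<^sub>t (y * y') = (x \<otimes>\<^sub>t y) * (x' \<otimes>\<^sub>t y')"
proof -
  note lin = flinear_comp [OF flinear_times_left linear_tensor_left]
    flinear_comp [OF flinear_times_left linear_tensor_right]
    flinear_comp [OF flinear_times_right linear_tensor_left]
    flinear_comp [OF flinear_times_right linear_tensor_right]
    flinear_comp [OF linear_tensor_left flinear_times_left]
    flinear_comp [OF linear_tensor_right flinear_times_left]
    flinear_comp [OF linear_tensor_left flinear_times_right]
    flinear_comp [OF linear_tensor_right flinear_times_right]
  \<comment> \<open>Four arguments have to be reduced to the basis and \<open>bilinear_ext\<close>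
    treats two at a time: here \<open>x'\<close> and \<open>y'\<close>, afterwards \<open>x\<close>
    and \<open>y\<close>.\<close>
  have step: "(single a 1 * x') \<otimes>\<^sub>t (single b 1 * y') = single (a, b) 1 * (x' \<otimes>\<^sub>t y')"
    for a :: 'a and b :: 'b and x' y'
    by (rule bilinear_ext) (auto intro: lin simp: mult_single simp del: mult_1)
  show ?thesis
    by (rule bilinear_ext) (auto intro: lin simp: step)
qed

lemma tensor_map_times:
  fixes f :: "('a::monoid_add \<Rightarrow>\<^sub>0 'k::field) \<Rightarrow> ('c::monoid_add \<Rightarrow>\<^sub>0 'k)"
    and g :: "('b::monoid_add \<Rightarrow>\<^sub>0 'k) \<Rightarrow> ('d::monoid_add \<Rightarrow>\<^sub>0 'k)"
  assumes "\<And>x y. f (x * y) = f x * f y" "\<And>x y. g (x * y) = g x * g y"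
  shows "tensor_map f g (X * Y) = tensor_map f g X * tensor_map f g Y"
proof (rule flinear_multiplicativeI)
  show "flinear (tensor_map f g)" unfolding tensor_map_def by (rule linear_lin_ext)
  have "f (single (a + c) 1) = f (single a 1) * f (single c 1)" for a c
    using assms(1) [of "single a 1" "single c 1"] by (simp add: mult_single)
  moreover have "g (single (a + c) 1) = g (single a 1) * g (single c 1)" for a c
    using assms(2) [of "single a 1" "single c 1"] by (simp add: mult_single)
  ultimately show "tensor_map f g (single (p + q) 1) =
      tensor_map f g (single p 1) * tensor_map f g (single q 1)" for p q
    by (cases p; cases q) (simp add: tensor_map_def tensor_times)
qed

lemma tensor_assoc_times:
  fixes X Y :: "('a::monoid_add \<times> 'b::monoid_add) \<times> 'c::monoid_add \<Rightarrow>\<^sub>0 'k::field"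
  shows "tensor_assoc (X * Y) = tensor_assoc X * tensor_assoc Y"
proof (rule flinear_multiplicativeI)
  show "flinear (tensor_assoc :: (('a \<times> 'b) \<times> 'c \<Rightarrow>\<^sub>0 'k) \<Rightarrow> _)"
    unfolding tensor_assoc_def by (rule linear_lin_ext)
qed (auto simp: tensor_assoc_def mult_single)

text \<open>Words form the free monoid, so an algebra homomorphism is fixed by its values on
  letters. This carries the reduction to a single partition.\<close>

lemma word_algebra_hom_ext:
  fixes f g :: "('a list \<Rightarrow>\<^sub>0 'k::field) \<Rightarrow> ('b::monoid_add \<Rightarrow>\<^sub>0 'k)"
  assumes "flinear f" "flinear g"
    and "\<And>x y. f (x * y) = f x * f y" "\<And>x y. g (x * y) = g x * g y" "f 1 = g 1"
    and "\<And>a. f (single [a] 1) = g (single [a] 1)"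
  shows "f = g"
proof (rule linear_ext [OF assms(1,2)])
  show "f (single w 1) = g (single w 1)" for w
  proof (induction w)
    case Nil
    then show ?case using assms(5) by (simp add: single_one [symmetric] zero_list_def del: single_one)
  next
    case (Cons a w)
    have "single (a # w) 1 = single [a] 1 * single w (1 :: 'k)"
      by (simp add: mult_single plus_list_def)
    then show ?case using assms(3,4,6) Cons by simp
  qed
qed

section \<open>The bar algebra as a monoid algebra of words\<close>

lemma bar_mult_eq_times: "bar_mult = (*)"
proof (intro ext)
  show "bar_mult x y = x * y" for x y :: "'k::field TNC"
    unfolding bar_mult_def
    by (rule bilinear_ext)
      (auto intro: flinear_comp [OF linear_tensor_left linear_lin_ext]
        flinear_comp [OF linear_tensor_right linear_lin_ext] flinear_times_left flinear_times_right
        simp: mult_single plus_list_def)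
qed

lemma bar_one_eq_one: "bar_one = 1"
  by (simp add: bar_one_def single_one [symmetric] zero_list_def del: single_one)

lemma one_tensor_one:
  "(1 :: 'a::monoid_add \<Rightarrow>\<^sub>0 'k::field) \<otimes>\<^sub>t (1 :: 'b::monoid_add \<Rightarrow>\<^sub>0 'k) = 1"
  unfolding single_one [symmetric] by (simp add: zero_prod_def del: single_one)

text \<open>As a product in a ring, the coproduct of a concatenated word splits at once.\<close>

lemma nc_coproduct_word_eq_prod: "nc_coproduct_word w = prod_list (map nc_coproduct_basis w)"
  unfolding nc_coproduct_word_def bar_mult_eq_times bar_one_eq_one
  by (induction w) (simp_all add: tensor_mult_times one_tensor_one)

lemma flinear_nc_coproduct: "flinear nc_coproduct"
  unfolding nc_coproduct_def by (rule linear_lin_ext)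

lemma nc_coproduct_single: "nc_coproduct (single w 1) = nc_coproduct_word w"
  by (simp add: nc_coproduct_def)

lemma nc_coproduct_times: "nc_coproduct (x * y) = nc_coproduct x * nc_coproduct y"
  by (rule flinear_multiplicativeI)
    (simp_all add: flinear_nc_coproduct nc_coproduct_single nc_coproduct_word_eq_prod plus_list_def)

lemma nc_coproduct_one: "nc_coproduct 1 = 1"
  using nc_coproduct_single [of "[]"]
  by (simp add: nc_coproduct_word_eq_prod single_one [symmetric] zero_list_def del: single_one)

subsection \<open>Gaps\<close>

abbreviation block_less :: "nat set \<Rightarrow> nat set \<Rightarrow> bool" where
  "block_less I J \<equiv> \<forall>i\<in>I. \<forall>j\<in>J. i < j"

text \<open>Two nonempty blocks cannot each precede the other, so the heads coincide, and a nonempty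
  head does not recur in its tail. Every identity between gap lists is thereby reduced to an
  identity of sets together with sortedness.\<close>

lemma sorted_blocks_unique:
  assumes "sorted_wrt block_less Is" "sorted_wrt block_less Js" "set Is = set Js" "{} \<notin> set Is"
  shows "Is = Js"
  using assms
proof (induction Is arbitrary: Js)
  case (Cons I Is)
  then obtain J Js' where Js: "Js = J # Js'" by (cases Js) auto
  have "I = J"
  proof (rule ccontr)
    assume "I \<noteq> J"
    then have "J \<in> set Is" "I \<in> set Js'" using Cons.prems(3) Js by auto
    then have "block_less I J" "block_less J I"
      using Cons.prems(1,2) unfolding Js sorted_wrt.simps by blast+
    moreover have "I \<noteq> {}" "J \<noteq> {}" using Cons.prems(3,4) Js by auto
    ultimately show False by (meson all_not_in_conv less_asym)
  qed
  have notin: "K \<notin> set Ks" if "sorted_wrt block_less (K # Ks)" "K \<noteq> {}" for K Ks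
    using that by auto
  have "I \<notin> set Is" by (rule notin [OF Cons.prems(1)]) (use Cons.prems(4) in auto)
  moreover have "I \<notin> set Js'" by (rule notin) (use Cons.prems(2,4) Js \<open>I = J\<close> in \<open>simp, auto\<close>)
  ultimately have "set Is = set Js'"
    using Cons.prems(3) Js \<open>I = J\<close> by (auto simp: insert_ident)
  moreover have "sorted_wrt block_less Is" "sorted_wrt block_less Js'" "{} \<notin> set Is"
    using Cons.prems(1,2,4) unfolding Js by simp_all
  ultimately have "Is = Js'" using Cons.IH by blast
  then show ?case using Js \<open>I = J\<close> by simp
qed simp

text \<open>Sorting by the least element works: of the two possible orders of distinct blocks, it
  excludes the wrong one.\<close>

lemma sorted_blocks_exist:
  assumes fin: "finite \<A>" and ne: "{} \<notin> \<A>"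
    and tot: "\<And>I J. I \<in> \<A> \<Longrightarrow> J \<in> \<A> \<Longrightarrow> I \<noteq> J \<Longrightarrow> block_less I J \<or> block_less J I"
  shows "\<exists>Js. set Js = \<A> \<and> sorted_wrt block_less Js"
proof -
  obtain xs where xs: "set xs = \<A>" "distinct xs"
    using finite_distinct_list [OF fin] by blast
  define ys where "ys = sort_key Inf xs"
  have ys: "set ys = \<A>" "distinct ys" "sorted (map Inf ys)"
    using xs by (simp_all add: ys_def)
  have "block_less (ys ! i) (ys ! j)" if "i < j" "j < length ys" for i j
  proof -
    have mem: "ys ! i \<in> \<A>" "ys ! j \<in> \<A>" using ys(1) that by (auto simp flip: ys(1))
    have "ys ! i \<noteq> ys ! j" using ys(2) that by (simp add: nth_eq_iff_index_eq)
    moreover have "Inf (ys ! i) \<le> Inf (ys ! j)"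
      using sorted_nth_mono [OF ys(3), of i j] that by simp
    moreover have "Inf (ys ! i) \<in> ys ! i" "Inf (ys ! j) \<in> ys ! j"
      using mem ne by (metis Inf_nat_def1)+
    ultimately show ?thesis using tot [OF mem] by force
  qed
  then have "sorted_wrt block_less ys" unfolding sorted_wrt_iff_nth_less by blast
  then show ?thesis using ys(1) by blast
qed

lemma sorted_blocks_concat:
  assumes "sorted_wrt block_less Js"
    and "\<And>J. J \<in> set Js \<Longrightarrow> sorted_wrt block_less (f J)"
    and "\<And>J K. J \<in> set Js \<Longrightarrow> K \<in> set (f J) \<Longrightarrow> K \<subseteq> J"
  shows "sorted_wrt block_less (concat (map f Js))"
  using assms
proof (induction Js)
  case (Cons J Js)
  have "block_less K K'" if "K \<in> set (f J)" "K' \<in> set (f J')" "J' \<in> set Js" for K K' J'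
  proof -
    have "K \<subseteq> J" "K' \<subseteq> J'" "block_less J J'" using Cons.prems that by auto
    then show ?thesis by blast
  qed
  then show ?case using Cons by (auto simp: sorted_wrt_append)
qed simp

text \<open>
  The relation \<open>\<forall>z\<in>Y. z < x \<longleftrightarrow> z < y\<close> says that no element of \<open>Y\<close> separates \<open>x\<close> from \<open>y\<close>. Unlike
  runs, gaps are relative to the ground set \<open>X\<close> and hence compatible with standardization.
\<close>

definition gaps :: "nat set \<Rightarrow> nat set \<Rightarrow> nat set set" where
  "gaps X Y = (\<lambda>x. {y \<in> X - Y. \<forall>z\<in>Y. z < x \<longleftrightarrow> z < y}) ` (X - Y)"

definition gap_list :: "nat set \<Rightarrow> nat set \<Rightarrow> nat set list" where
  "gap_list X Y = (THE Js. set Js = gaps X Y \<and> sorted_wrt block_less Js)"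

lemma gaps_nonempty: "{} \<notin> gaps X Y"
  by (auto simp: gaps_def)

lemma Union_gaps: "\<Union>(gaps X Y) = X - Y"
  by (auto simp: gaps_def)

text \<open>Distinct gaps have representatives separated by some point of \<open>Y\<close>, and that
  point then lies between all of one gap and all of the other.\<close>

lemma gaps_ordered:
  assumes "I \<in> gaps X Y" "J \<in> gaps X Y" "I \<noteq> J"
  shows "block_less I J \<or> block_less J I"
proof -
  obtain x y where x: "x \<in> X - Y" "I = {u \<in> X - Y. \<forall>z\<in>Y. z < x \<longleftrightarrow> z < u}"
    and y: "y \<in> X - Y" "J = {u \<in> X - Y. \<forall>z\<in>Y. z < y \<longleftrightarrow> z < u}"
    using assms by (auto simp: gaps_def)
  then obtain z where z: "z \<in> Y" "(z < x) \<noteq> (z < y)"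
    using assms(3) by blast
  have "z \<noteq> u" if "u \<in> I \<union> J" for u using that z x y by auto
  then have "(\<forall>u\<in>I. u < z \<longleftrightarrow> \<not> z < x)" "(\<forall>u\<in>J. u < z \<longleftrightarrow> \<not> z < y)"
    "(\<forall>u\<in>I. z < u \<longleftrightarrow> z < x)" "(\<forall>u\<in>J. z < u \<longleftrightarrow> z < y)"
    using x(2) y(2) z(1) by (auto simp: not_less_iff_gr_or_eq)
  then show ?thesis using z(2) by (metis less_trans)
qed

lemma gap_list_eqI:
  assumes "set Js = gaps X Y" "sorted_wrt block_less Js"
  shows "gap_list X Y = Js"
  unfolding gap_list_def
  by (rule the_equality) (use assms gaps_nonempty in \<open>auto intro!: sorted_blocks_unique\<close>)

lemma
  assumes "finite X"
  shows set_gap_list: "set (gap_list X Y) = gaps X Y"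
    and sorted_gap_list: "sorted_wrt block_less (gap_list X Y)"
proof -
  have "finite (gaps X Y)" using assms by (simp add: gaps_def)
  then obtain Js where "set Js = gaps X Y" "sorted_wrt block_less Js"
    using sorted_blocks_exist [OF _ gaps_nonempty, of X Y] gaps_ordered [of _ X Y] by meson
  with gap_list_eqI [of Js X Y]
  show "set (gap_list X Y) = gaps X Y" "sorted_wrt block_less (gap_list X Y)" by auto
qed

lemma distinct_gap_list:
  assumes "finite X"
  shows "distinct (gap_list X Y)"
proof -
  have "distinct Js" if "sorted_wrt block_less Js" "{} \<notin> set Js" for Js
    using that by (induction Js) auto
  from this [OF sorted_gap_list [OF assms]] show ?thesis
    by (simp add: set_gap_list [OF assms] gaps_nonempty)
qed

lemma gap_convex:
  assumes J: "J \<in> gaps X Y" and uw: "u \<in> J" "w \<in> J" and v: "v \<in> X" "u \<le> v" "v \<le> w"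
  shows "v \<in> J"
proof -
  obtain x where x: "J = {y \<in> X - Y. \<forall>z\<in>Y. z < x \<longleftrightarrow> z < y}"
    using J by (auto simp: gaps_def)
  have "v \<notin> Y" using uw v unfolding x by (metis (mono_tags, lifting) DiffE le_neq_implies_less leD mem_Collect_eq)
  moreover have "z < x \<longleftrightarrow> z < v" if "z \<in> Y" for z
    using uw v that unfolding x by (metis (mono_tags, lifting) less_le_trans mem_Collect_eq)
  ultimately show ?thesis using v(1) x by blast
qed

lemma consecutive_subset_gap:
  assumes J: "J \<in> gaps X Y" and K: "consecutive K" "K \<subseteq> X - Y" "K \<inter> J \<noteq> {}"
  shows "K \<subseteq> J"
proof
  fix y assume y: "y \<in> K"
  obtain x where x: "J = {y \<in> X - Y. \<forall>z\<in>Y. z < x \<longleftrightarrow> z < y}"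
    using J by (auto simp: gaps_def)
  obtain w where w: "w \<in> K" "w \<in> J" using K(3) by blast
  obtain a b where ab: "K = {a..b}" using K(1) by (auto simp: consecutive_def)
  have "z < w \<longleftrightarrow> z < y" if "z \<in> Y" for z
  proof (rule ccontr)
    assume "(z < w) \<noteq> (z < y)"
    then have "z \<in> K" using w(1) y unfolding ab by auto
    then show False using K(2) that by blast
  qed
  then show "y \<in> J" using w(2) y K(2) unfolding x by auto
qed

text \<open>In an interval a gap is convex, hence consecutive; and a consecutive set avoiding
  \<open>Y\<close> cannot leave a gap that it meets, since the separating point would lie in
  it.\<close>

lemma runs_eq_gaps: "runs ({1..n} - Y) = gaps {1..n} Y"
proof -
  have cons: "consecutive J" if J: "J \<in> gaps {1..n} Y" for J
  proof -
    have sub: "J \<subseteq> {1..n} - Y" and ne: "J \<noteq> {}"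
      using J Union_gaps [of "{1..n}" Y] gaps_nonempty [of "{1..n}" Y] by auto
    have fin: "finite J" by (rule finite_subset [OF sub]) simp
    have "J = {Min J..Max J}"
    proof (intro equalityI subsetI)
      fix v assume v: "v \<in> {Min J..Max J}"
      have mem: "Min J \<in> J" "Max J \<in> J" using fin ne by auto
      then have "1 \<le> Min J" "Max J \<le> n" using sub by auto
      then have "v \<in> {1..n}" using v by simp
      then show "v \<in> J" using gap_convex [OF J mem] v by simp
    qed (use fin in auto)
    moreover have "Min J \<le> Max J" using fin ne by simp
    ultimately show ?thesis unfolding consecutive_def by blast
  qed
  show ?thesis
  proof (intro equalityI subsetI)
    fix K assume "K \<in> runs ({1..n} - Y)"
    then have K: "consecutive K" "K \<subseteq> {1..n} - Y"
      and max: "\<And>K'. consecutive K' \<Longrightarrow> K' \<subseteq> {1..n} - Y \<Longrightarrow> K \<subseteq> K' \<Longrightarrow> K' = K"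
      by (auto simp: runs_def)
    have "K \<noteq> {}" using K(1) by (auto simp: consecutive_def)
    then obtain x where x: "x \<in> K" by blast
    then obtain J where J: "J \<in> gaps {1..n} Y" "x \<in> J"
      using K(2) Union_gaps [of "{1..n}" Y] by blast
    have "K \<subseteq> J" by (rule consecutive_subset_gap [OF J(1) K]) (use x J in auto)
    moreover have "J \<subseteq> {1..n} - Y" using J Union_gaps [of "{1..n}" Y] by blast
    ultimately have "J = K" using max cons [OF J(1)] by blast
    then show "K \<in> gaps {1..n} Y" using J by simp
  next
    fix J assume J: "J \<in> gaps {1..n} Y"
    then have "J \<subseteq> {1..n} - Y" "J \<noteq> {}"
      using Union_gaps [of "{1..n}" Y] gaps_nonempty [of "{1..n}" Y] by auto
    then show "J \<in> runs ({1..n} - Y)"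
      using cons [OF J] consecutive_subset_gap [OF J] unfolding runs_def by blast
  qed
qed

lemma run_list_eq_gap_list: "run_list ({1..n} - Y) = gap_list {1..n} Y"
  unfolding run_list_def gap_list_def runs_eq_gaps ..

lemma gap_list_empty: "finite X \<Longrightarrow> X \<noteq> {} \<Longrightarrow> gap_list X {} = [X]"
  by (rule gap_list_eqI) (auto simp: gaps_def)

text \<open>Cutting can be done in two stages, because a point of \<open>Y'\<close> outside a gap of
  \<open>Y\<close> never separates two points of that gap. This governs the third tensor factor in
  coassociativity.\<close>

lemma gap_list_Un:
  assumes X: "finite X" and Y: "Y \<subseteq> X" "Y' \<subseteq> X" "Y \<inter> Y' = {}"
  shows "gap_list X (Y \<union> Y') = concat (map (\<lambda>J. gap_list J (Y' \<inter> J)) (gap_list X Y))"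
proof (rule gap_list_eqI)
  have sub: "J \<subseteq> X" if "J \<in> gaps X Y" for J using that Union_gaps [of X Y] by blast
  then have fin: "finite J" if "J \<in> gaps X Y" for J using that X finite_subset by blast
  define c where "c x = {y \<in> X - Y. \<forall>z\<in>Y. z < x \<longleftrightarrow> z < y}" for x
  have gaps_c: "gaps X Y = c ` (X - Y)" by (simp add: gaps_def c_def)
  have cD: "u \<in> X - Y" "\<And>z. z \<in> Y \<Longrightarrow> z < x \<longleftrightarrow> z < u" if "u \<in> c x" for u x
    using that unfolding c_def by blast+
  have step: "{y \<in> c x - (Y' \<inter> c x). \<forall>z\<in>Y' \<inter> c x. z < x' \<longleftrightarrow> z < y} =
      {y \<in> X - (Y \<union> Y'). \<forall>z\<in>Y \<union> Y'. z < x' \<longleftrightarrow> z < y}" (is "?A = ?B")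
    if x': "x' \<in> c x" for x x'
  proof (intro equalityI subsetI)
    fix y assume y: "y \<in> ?A"
    then have yc: "y \<in> c x" "y \<notin> Y'" by blast+
    \<comment> \<open>Such a \<open>z\<close> is cut off from the gap by some \<open>w\<close> in
      \<open>Y\<close>, and \<open>x'\<close> and \<open>y\<close> lie on the same side of
      \<open>w\<close>, hence on the same side of \<open>z\<close>.\<close>
    have sep: "z < x' \<longleftrightarrow> z < y" if z: "z \<in> Y' - c x" for z
    proof -
      have "z \<in> X - Y" using z Y by auto
      then obtain w where w: "w \<in> Y" "(w < x) \<noteq> (w < z)" using z unfolding c_def by blast
      moreover have "w < x \<longleftrightarrow> w < x'" "w < x \<longleftrightarrow> w < y"
        using cD(2) [OF x' w(1)] cD(2) [OF yc(1) w(1)] by simp_all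
      moreover have "w \<noteq> x'" "w \<noteq> y" "w \<noteq> z"
        using cD(1) [OF x'] cD(1) [OF yc(1)] w(1) \<open>z \<in> X - Y\<close> by auto
      ultimately show ?thesis by linarith
    qed
    have "z < x' \<longleftrightarrow> z < y" if "z \<in> Y \<union> Y'" for z
    proof (cases "z \<in> Y")
      case True
      then show ?thesis using cD(2) [OF yc(1)] cD(2) [OF x'] by blast
    next
      case False
      then show ?thesis using y that sep [of z] by (cases "z \<in> c x") blast+
    qed
    then show "y \<in> ?B" using yc cD(1) [OF yc(1)] by blast
  next
    fix y assume y: "y \<in> ?B"
    then have "y \<in> X - Y" "\<forall>z\<in>Y. z < x \<longleftrightarrow> z < y" using cD(2) [OF x'] by blast+
    then have "y \<in> c x" unfolding c_def by blast
    then show "y \<in> ?A" using y by blast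
  qed
  show "set (concat (map (\<lambda>J. gap_list J (Y' \<inter> J)) (gap_list X Y))) = gaps X (Y \<union> Y')"
  proof -
    have "set (concat (map (\<lambda>J. gap_list J (Y' \<inter> J)) (gap_list X Y))) =
        (\<Union>J\<in>gaps X Y. gaps J (Y' \<inter> J))"
      using fin by (simp add: set_gap_list X)
    also have "\<dots> = (\<Union>x\<in>X - Y. (\<lambda>x'. {y \<in> X - (Y \<union> Y'). \<forall>z\<in>Y \<union> Y'. z < x' \<longleftrightarrow> z < y}) ` (c x - Y' \<inter> c x))"
    proof -
      have "gaps (c x) (Y' \<inter> c x) =
          (\<lambda>x'. {y \<in> X - (Y \<union> Y'). \<forall>z\<in>Y \<union> Y'. z < x' \<longleftrightarrow> z < y}) ` (c x - Y' \<inter> c x)" for x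
        unfolding gaps_def by (rule image_cong [OF refl]) (rule step, simp)
      then show ?thesis by (simp only: gaps_c UN_simps)
    qed
    also have "\<dots> = gaps X (Y \<union> Y')"
    proof -
      have "(\<Union>x\<in>X - Y. c x - Y' \<inter> c x) = X - (Y \<union> Y')"
        unfolding c_def by auto
      then show ?thesis unfolding gaps_def by (metis image_UN)
    qed
    finally show ?thesis .
  qed
  show "sorted_wrt block_less (concat (map (\<lambda>J. gap_list J (Y' \<inter> J)) (gap_list X Y)))"
  proof (rule sorted_blocks_concat [OF sorted_gap_list [OF X]])
    fix J assume "J \<in> set (gap_list X Y)"
    then have J: "finite J" using fin set_gap_list [OF X] by simp
    then show "sorted_wrt block_less (gap_list J (Y' \<inter> J))" by (rule sorted_gap_list)
    show "K \<subseteq> J" if "K \<in> set (gap_list J (Y' \<inter> J))" for K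
      using that Union_gaps [of J "Y' \<inter> J"] by (auto simp: set_gap_list [OF J])
  qed
qed

text \<open>The separating points are those of \<open>Y\<close> in both ground sets, so shrinking
  \<open>X\<close> only removes points from gaps, and gaps that become empty disappear. This governs
  the middle tensor factor.\<close>

lemma gap_list_sub:
  assumes X: "finite X" and Y: "Y \<subseteq> X" "Y' \<subseteq> X" "Y \<inter> Y' = {}"
  shows "gap_list (Y \<union> Y') Y =
    concat (map (\<lambda>J. if J \<inter> Y' = {} then [] else [J \<inter> Y']) (gap_list X Y))"
proof (rule gap_list_eqI)
  show "set (concat (map (\<lambda>J. if J \<inter> Y' = {} then [] else [J \<inter> Y']) (gap_list X Y))) = gaps (Y \<union> Y') Y"
  proof -
    define c where "c x = {y \<in> X - Y. \<forall>z\<in>Y. z < x \<longleftrightarrow> z < y}" for x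
    have "set (concat (map (\<lambda>J. if J \<inter> Y' = {} then [] else [J \<inter> Y']) (gap_list X Y))) =
        {J \<inter> Y' |J. J \<in> c ` (X - Y) \<and> J \<inter> Y' \<noteq> {}}"
      using X by (auto simp: set_gap_list gaps_def c_def split: if_splits)
    also have "\<dots> = (\<lambda>x. c x \<inter> Y') ` Y'"
    proof (intro equalityI subsetI)
      fix K assume "K \<in> {J \<inter> Y' |J. J \<in> c ` (X - Y) \<and> J \<inter> Y' \<noteq> {}}"
      then obtain x y where x: "K = c x \<inter> Y'" "y \<in> c x \<inter> Y'" by auto
      then have "c x = c y" unfolding c_def by auto
      then show "K \<in> (\<lambda>x. c x \<inter> Y') ` Y'" using x by auto
    next
      fix K assume "K \<in> (\<lambda>x. c x \<inter> Y') ` Y'"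
      then obtain x where x: "x \<in> Y'" "K = c x \<inter> Y'" by auto
      moreover have "x \<in> c x" "x \<in> X - Y" using x Y unfolding c_def by auto
      ultimately show "K \<in> {J \<inter> Y' |J. J \<in> c ` (X - Y) \<and> J \<inter> Y' \<noteq> {}}" by auto
    qed
    also have "\<dots> = gaps (Y \<union> Y') Y"
    proof -
      have "Y \<union> Y' - Y = Y'" using Y by auto
      moreover have "c x \<inter> Y' = {y \<in> Y'. \<forall>z\<in>Y. z < x \<longleftrightarrow> z < y}" for x using Y unfolding c_def by auto
      ultimately show ?thesis by (simp add: gaps_def)
    qed
    finally show ?thesis .
  qed
  show "sorted_wrt block_less (concat (map (\<lambda>J. if J \<inter> Y' = {} then [] else [J \<inter> Y']) (gap_list X Y)))"
    by (rule sorted_blocks_concat) (auto simp: sorted_gap_list [OF X] split: if_splits)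
qed

text \<open>Separation is expressed by comparisons between points of \<open>X\<close> alone, which
  an increasing map preserves.\<close>

lemma gap_list_image:
  assumes X: "finite X" and Y: "Y \<subseteq> X" and f: "strict_mono_on X f"
  shows "gap_list (f ` X) (f ` Y) = map ((`) f) (gap_list X Y)"
proof (rule gap_list_eqI)
  have less: "f x < f y \<longleftrightarrow> x < y" if "x \<in> X" "y \<in> X" for x y
    using strict_mono_on_less [OF f that] .
  have inj: "inj_on f X" by (rule strict_mono_on_imp_inj_on [OF f])
  have diff: "f ` X - f ` Y = f ` (X - Y)"
    by (rule inj_on_image_set_diff [OF inj, symmetric]) (use Y in auto)
  have "{y \<in> f ` (X - Y). \<forall>z\<in>f ` Y. z < f x \<longleftrightarrow> z < y} = f ` {y \<in> X - Y. \<forall>z\<in>Y. z < x \<longleftrightarrow> z < y}"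
    if "x \<in> X - Y" for x
    using that Y by (auto simp: less subset_iff)
  then show "set (map ((`) f) (gap_list X Y)) = gaps (f ` X) (f ` Y)"
    by (simp add: set_gap_list X gaps_def diff image_image)
  have "sorted_wrt (\<lambda>I J. block_less (f ` I) (f ` J)) (gap_list X Y)"
  proof (rule sorted_wrt_mono_rel [OF _ sorted_gap_list [OF X]])
    fix I J assume "I \<in> set (gap_list X Y)" "J \<in> set (gap_list X Y)" and IJ: "block_less I J"
    then have "I \<subseteq> X" "J \<subseteq> X" using Union_gaps [of X Y] by (auto simp: set_gap_list X)
    then show "block_less (f ` I) (f ` J)" using IJ less by blast
  qed
  then show "sorted_wrt block_less (map ((`) f) (gap_list X Y))"
    by (simp add: sorted_wrt_map)
qed

subsection \<open>The coproduct of a non-crossing partition\<close>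

text \<open>The word \<open>residual_word\<close> with runs replaced by gaps in the ground set, so
  that it has the intended meaning for partitions of any finite set of integers.\<close>

definition residual :: "nat set set \<Rightarrow> nat set set \<Rightarrow> ncp list" where
  "residual P Q = map (\<lambda>J. Abs_ncp (st_partition {B \<in> P - Q. B \<subseteq> J})) (gap_list (\<Union>P) (\<Union>Q))"

lemma residual_word_eq_residual:
  assumes "L \<in> NC n"
  shows "residual_word L Q = residual L Q"
proof -
  have "\<Union>L = {1..n}" using assms by (simp add: NC_def partition_on_def)
  then show ?thesis by (simp only: residual_word_def residual_def run_list_eq_gap_list)
qed

section \<open>Invariance under increasing relabelling\<close>

lemma st_image:
  assumes "strict_mono_on S f" "x \<in> S"
  shows "st (f ` S) (f x) = st S x"
proof -
  have "{y \<in> f ` S. y \<le> f x} = f ` {y \<in> S. y \<le> x}"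
    using strict_mono_on_less_eq [OF assms(1)] assms(2) by auto
  moreover have "inj_on f {y \<in> S. y \<le> x}"
    by (rule inj_on_subset [OF strict_mono_on_imp_inj_on [OF assms(1)]]) auto
  ultimately show ?thesis unfolding st_def by (simp add: card_image)
qed

lemma Union_image_image: "\<Union>((`) f ` P) = f ` \<Union>P"
  by auto

lemma st_partition_image:
  assumes "strict_mono_on (\<Union>P) f"
  shows "st_partition ((`) f ` P) = st_partition P"
proof -
  have "st (f ` \<Union>P) ` f ` B = st (\<Union>P) ` B" if "B \<in> P" for B
    unfolding image_image
    by (rule image_cong [OF refl]) (use that in \<open>auto intro: st_image [OF assms]\<close>)
  then show ?thesis
    unfolding st_partition_def Union_image_image image_image [of _ "(`) f"]
    by (rule image_cong [OF refl])
qed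

lemma st_word_image: "strict_mono_on (\<Union>P) f \<Longrightarrow> st_word ((`) f ` P) = st_word P"
  by (simp add: st_word_def st_partition_image)

text \<open>Trades \<open>Inf\<close> and \<open>Sup\<close> for comparisons between points, the
  form that transfers along increasing maps.\<close>

lemma nested_iff:
  assumes "finite C" "C \<noteq> {}"
  shows "nested B C \<longleftrightarrow> (\<forall>m\<in>B. (\<exists>c\<in>C. c < m) \<and> (\<exists>c\<in>C. m < c))"
proof -
  have "Inf C < m \<longleftrightarrow> (\<exists>c\<in>C. c < m)" "m < Sup C \<longleftrightarrow> (\<exists>c\<in>C. m < c)" for m
    using assms by (auto simp: cInf_less_iff less_cSup_iff)
  then show ?thesis by (simp add: nested_def)
qed

lemma nested_image:
  assumes "strict_mono_on S f" "B \<subseteq> S" "C \<subseteq> S" "finite C" "C \<noteq> {}"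
  shows "nested (f ` B) (f ` C) \<longleftrightarrow> nested B C"
proof -
  have "f x < f y \<longleftrightarrow> x < y" if "x \<in> S" "y \<in> S" for x y
    using strict_mono_on_less [OF assms(1) that] .
  then have "(\<exists>c\<in>C. f c < f m) \<longleftrightarrow> (\<exists>c\<in>C. c < m)" "(\<exists>c\<in>C. f m < f c) \<longleftrightarrow> (\<exists>c\<in>C. m < c)"
    if "m \<in> B" for m
    using that assms(2,3) by (auto intro!: bex_cong)
  then show ?thesis using assms(4,5) by (simp add: nested_iff)
qed

context
  fixes S :: "nat set" and P :: "nat set set" and f :: "nat \<Rightarrow> nat"
  assumes S: "finite S" and P: "partition_on S P" and f: "strict_mono_on S f"
begin

lemma inj_on_image_blocks: "inj_on ((`) f) P"
proof (rule inj_onI)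
  fix B C assume "B \<in> P" "C \<in> P" "f ` B = f ` C"
  moreover have "B \<subseteq> S" "C \<subseteq> S" using P calculation(1,2) by (auto simp: partition_on_def)
  ultimately show "B = C"
    using inj_on_image_eq_iff [OF strict_mono_on_imp_inj_on [OF f]] by blast
qed

lemma admissible_image:
  assumes "Q \<subseteq> P"
  shows "admissible ((`) f ` P) ((`) f ` Q) \<longleftrightarrow> admissible P Q"
proof -
  have diff: "(`) f ` P - (`) f ` Q = (`) f ` (P - Q)"
    by (rule inj_on_image_set_diff [OF inj_on_image_blocks, symmetric]) (use assms in auto)
  have "nested (f ` B) (f ` C) \<longleftrightarrow> nested B C" if "B \<in> P" "C \<in> P" for B C
  proof (rule nested_image [OF f])
    show BC: "B \<subseteq> S" "C \<subseteq> S" "C \<noteq> {}" using P that by (auto simp: partition_on_def)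
    show "finite C" by (rule finite_subset [OF BC(2) S])
  qed
  then have "(\<exists>B\<in>(`) f ` Q. \<exists>C\<in>(`) f ` (P - Q). nested B C) \<longleftrightarrow> (\<exists>B\<in>Q. \<exists>C\<in>P - Q. nested B C)"
    using assms by blast
  moreover have "(`) f ` Q \<subseteq> (`) f ` P" using assms by (rule image_mono)
  ultimately show ?thesis unfolding admissible_def diff using assms by simp
qed

lemma admissible_image_Collect:
  "{Q. admissible ((`) f ` P) Q} = (`) ((`) f) ` {Q. admissible P Q}"
proof (intro equalityI subsetI)
  fix Q' assume "Q' \<in> {Q. admissible ((`) f ` P) Q}"
  moreover from this obtain Q where "Q \<subseteq> P" "Q' = (`) f ` Q"
    unfolding admissible_def by (auto simp: subset_image_iff)
  ultimately show "Q' \<in> (`) ((`) f) ` {Q. admissible P Q}" using admissible_image by blast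
next
  fix Q' assume "Q' \<in> (`) ((`) f) ` {Q. admissible P Q}"
  then obtain Q where "Q' = (`) f ` Q" "admissible P Q" by blast
  moreover from this have "Q \<subseteq> P" by (simp add: admissible_def)
  ultimately show "Q' \<in> {Q. admissible ((`) f ` P) Q}" using admissible_image by blast
qed

lemma residual_image:
  assumes "Q \<subseteq> P"
  shows "residual ((`) f ` P) ((`) f ` Q) = residual P Q"
proof -
  have U: "\<Union>P = S" using P by (simp add: partition_on_def)
  have inj: "inj_on f S" by (rule strict_mono_on_imp_inj_on [OF f])
  have diff: "(`) f ` P - (`) f ` Q = (`) f ` (P - Q)"
    by (rule inj_on_image_set_diff [OF inj_on_image_blocks, symmetric]) (use assms in auto)
  have "st_partition {B \<in> (`) f ` P - (`) f ` Q. B \<subseteq> f ` J} = st_partition {B \<in> P - Q. B \<subseteq> J}"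
    if "J \<in> gaps S (\<Union>Q)" for J
  proof -
    have J: "J \<subseteq> S" using that Union_gaps [of S "\<Union>Q"] by blast
    have "f ` B \<subseteq> f ` J \<longleftrightarrow> B \<subseteq> J" if "B \<in> P" for B
    proof
      have "B \<subseteq> S" using that U by blast
      then show "B \<subseteq> J" if "f ` B \<subseteq> f ` J"
        using that inj_on_image_mem_iff [OF inj _ J] by blast
    qed blast
    then have "{B \<in> (`) f ` P - (`) f ` Q. B \<subseteq> f ` J} = (`) f ` {B \<in> P - Q. B \<subseteq> J}"
      unfolding diff by blast
    moreover have "strict_mono_on (\<Union>{B \<in> P - Q. B \<subseteq> J}) f"
      by (rule monotone_on_subset [OF f]) (use J in auto)
    ultimately show ?thesis by (simp add: st_partition_image)
  qed
  moreover have "\<Union>Q \<subseteq> S" using assms U by blast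
  ultimately show ?thesis
    unfolding residual_def Union_image_image U
    by (simp add: gap_list_image [OF S _ f] set_gap_list [OF S])
qed

end

text \<open>The coproduct formula before standardization of the argument. It applies directly to
  subsets \<open>Q\<close> of a partition and to the blocks inside one gap.\<close>

definition coproduct_sum :: "nat set set \<Rightarrow> (ncp list \<times> ncp list \<Rightarrow>\<^sub>0 'k::field)" where
  "coproduct_sum P = (\<Sum>Q | admissible P Q. single (st_word Q, residual P Q) 1)"

lemma coproduct_sum_image:
  assumes "finite S" "partition_on S P" "strict_mono_on S f"
  shows "coproduct_sum ((`) f ` P) = coproduct_sum P"
proof -
  have inj: "inj_on ((`) ((`) f)) {Q. admissible P Q}"
    by (rule inj_on_subset [OF inj_on_image_Pow [OF inj_on_image_blocks [OF assms]]])
      (auto simp: admissible_def)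
  have "(st_word ((`) f ` Q), residual ((`) f ` P) ((`) f ` Q)) = (st_word Q, residual P Q)"
    if "admissible P Q" for Q
  proof -
    have Q: "Q \<subseteq> P" using that by (simp add: admissible_def)
    have "strict_mono_on (\<Union>Q) f"
      by (rule monotone_on_subset [OF assms(3)]) (use Q assms(2) in \<open>auto simp: partition_on_def\<close>)
    then show ?thesis by (simp add: st_word_image residual_image [OF assms Q])
  qed
  then show ?thesis
    unfolding coproduct_sum_def admissible_image_Collect [OF assms] sum.reindex [OF inj]
    by simp
qed

lemma Rep_Abs_ncp: "P \<in> NC n \<Longrightarrow> 1 \<le> n \<Longrightarrow> Rep_ncp (Abs_ncp P) = P"
  by (rule Abs_ncp_inverse) auto

lemma Rep_Abs_ncp_st_partition:
  assumes "finite S" "partition_on S P" "noncrossing P" "P \<noteq> {}"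
  shows "Rep_ncp (Abs_ncp (st_partition P)) = st_partition P"
proof -
  have "S \<noteq> {}" using assms(2,4) by (auto simp: partition_on_def)
  then have "1 \<le> card S" using assms(1) by (simp add: Suc_leI card_gt_0_iff)
  then show ?thesis by (rule Rep_Abs_ncp [OF st_partition_NC [OF assms(1-3)]])
qed

lemma nc_coproduct_basis_eq: "nc_coproduct_basis L = coproduct_sum (Rep_ncp L)"
proof -
  obtain n where "Rep_ncp L \<in> NC n" using Rep_ncp [of L] by blast
  then show ?thesis
    by (simp add: nc_coproduct_basis_def coproduct_sum_def residual_word_eq_residual)
qed

lemma one_eq_single_Nil_Nil: "1 = single ([], []) 1"
  unfolding single_one [symmetric] by (simp only: zero_prod_def zero_list_def)

text \<open>Relabelling invariance removes the standardization. The case \<open>P = {}\<close> is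
  needed for the admissible choice \<open>Q = {}\<close>: there the single summand is the
  unit.\<close>

lemma nc_coproduct_word_st_word:
  assumes "finite S" "partition_on S P" "noncrossing P"
  shows "nc_coproduct_word (st_word P) = coproduct_sum P"
proof (cases "P = {}")
  case True
  have "{Q. admissible {} Q} = {{}}" by (auto simp: admissible_def)
  moreover have "gap_list {} {} = []" by (rule gap_list_eqI) (auto simp: gaps_def)
  ultimately show ?thesis
    unfolding True coproduct_sum_def
    by (simp add: nc_coproduct_word_eq_prod st_word_def residual_def one_eq_single_Nil_Nil [symmetric])
next
  case False
  have U: "\<Union>P = S" using assms(2) by (simp add: partition_on_def)
  have "nc_coproduct_word (st_word P) = coproduct_sum (st_partition P)"
    using False
    by (simp add: nc_coproduct_word_eq_prod st_word_def nc_coproduct_basis_eq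
      Rep_Abs_ncp_st_partition [OF assms])
  also have "\<dots> = coproduct_sum P"
    using coproduct_sum_image [OF assms(1,2) strict_mono_on_st [OF assms(1)]]
    by (simp add: st_partition_def U)
  finally show ?thesis .
qed

subsection \<open>Coassociativity\<close>

text \<open>The distributive law: since the sets \<open>P J\<close> are disjoint, one choice for
  each \<open>J\<close> is the same as one set \<open>R\<close> cut into its traces. The product
  stays a list product because the ring need not be commutative.\<close>

lemma prod_list_sum_expand:
  fixes g :: "'i \<Rightarrow> 'a set \<Rightarrow> 'r::semiring_1"
  assumes "distinct Js" "\<And>J. J \<in> set Js \<Longrightarrow> A J \<subseteq> Pow (P J)"
    and "\<And>I J. I \<in> set Js \<Longrightarrow> J \<in> set Js \<Longrightarrow> I \<noteq> J \<Longrightarrow> P I \<inter> P J = {}"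
  shows "(\<Prod>J\<leftarrow>Js. \<Sum>R\<in>A J. g J R) =
    (\<Sum>R | R \<subseteq> (\<Union>J\<in>set Js. P J) \<and> (\<forall>J\<in>set Js. R \<inter> P J \<in> A J). \<Prod>J\<leftarrow>Js. g J (R \<inter> P J))"
  using assms
proof (induction Js)
  case Nil
  have "{R. R \<subseteq> {}} = {{} :: 'a set}" by auto
  then show ?case by simp
next
  case (Cons I Js)
  define U where "U = (\<Union>J\<in>set Js. P J)"
  define T where "T = {R. R \<subseteq> U \<and> (\<forall>J\<in>set Js. R \<inter> P J \<in> A J)}"
  define T' where "T' = {R. R \<subseteq> P I \<union> U \<and> R \<inter> P I \<in> A I \<and> (\<forall>J\<in>set Js. R \<inter> P J \<in> A J)}"
  define h where "h R = (\<Prod>J\<leftarrow>Js. g J (R \<inter> P J))" for R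
  have AI: "R \<subseteq> P I" if "R \<in> A I" for R using Cons.prems(2) [of I] that by auto
  have disj: "P I \<inter> P J = {}" if "J \<in> set Js" for J
    using Cons.prems(1,3) that by auto
  then have disjU: "P I \<inter> U = {}" unfolding U_def by blast
  have PU: "P J \<subseteq> U" if "J \<in> set Js" for J using that unfolding U_def by blast
  have IH: "(\<Prod>J\<leftarrow>Js. \<Sum>R\<in>A J. g J R) = sum h T"
    unfolding T_def U_def h_def by (rule Cons.IH) (use Cons.prems in auto)
  have hcong: "h R = h R'" if "R \<inter> U = R' \<inter> U" for R R'
  proof -
    have "R \<inter> P J = R' \<inter> P J" if "J \<in> set Js" for J using PU [OF that] \<open>R \<inter> U = R' \<inter> U\<close> by blast
    then show ?thesis unfolding h_def by (auto intro!: arg_cong [of _ _ prod_list] map_cong)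
  qed
  have "(\<Prod>J\<leftarrow>I # Js. \<Sum>R\<in>A J. g J R) = (\<Sum>(R, R')\<in>A I \<times> T. g I R * h R')"
    by (simp add: IH sum_product sum.cartesian_product)
  also have "\<dots> = (\<Sum>R\<in>T'. g I (R \<inter> P I) * h R)"
  \<comment> \<open>A set \<open>R\<close> corresponds to its part inside \<open>P I\<close> and its
    part inside the remaining \<open>P J\<close>.\<close>
  proof (rule sum.reindex_bij_witness [of _ "\<lambda>R. (R \<inter> P I, R \<inter> U)" "\<lambda>(R, R'). R \<union> R'"])
    fix a assume "a \<in> A I \<times> T"
    then obtain R R' where a: "a = (R, R')" "R \<in> A I" "R' \<in> T" by auto
    have sub: "R \<subseteq> P I" "R' \<subseteq> U" using a AI unfolding T_def by auto
    then have eq: "(R \<union> R') \<inter> P I = R" "(R \<union> R') \<inter> U = R'" using disjU by blast+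
    then show "(\<lambda>R. (R \<inter> P I, R \<inter> U)) ((\<lambda>(R, R'). R \<union> R') a) = a" using a by simp
    have "(R \<union> R') \<inter> P J = R' \<inter> P J" if "J \<in> set Js" for J using sub disj [OF that] by blast
    then show "(\<lambda>(R, R'). R \<union> R') a \<in> T'"
      using a eq sub unfolding T_def T'_def by auto
    have "h (R \<union> R') = h R'" by (rule hcong) (use eq sub in blast)
    then show "g I ((\<lambda>(R, R'). R \<union> R') a \<inter> P I) * h ((\<lambda>(R, R'). R \<union> R') a) =
        (case a of (R, R') \<Rightarrow> g I R * h R')"
      using a eq by simp
  next
    fix R assume R: "R \<in> T'"
    then show "(\<lambda>(R, R'). R \<union> R') (R \<inter> P I, R \<inter> U) = R" unfolding T'_def by auto
    have "R \<inter> U \<inter> P J = R \<inter> P J" if "J \<in> set Js" for J using PU [OF that] by blast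
    then show "(R \<inter> P I, R \<inter> U) \<in> A I \<times> T" using R unfolding T_def T'_def by auto
  qed
  also have "T' = {R. R \<subseteq> (\<Union>J\<in>set (I # Js). P J) \<and> (\<forall>J\<in>set (I # Js). R \<inter> P J \<in> A J)}"
    unfolding T'_def U_def by simp
  finally show ?case by (simp add: h_def)
qed

lemma prod_list_single_pair:
  "(\<Prod>J\<leftarrow>Js. single (u J, v J) (1 :: 'k::field)) = single (concat (map u Js), concat (map v Js)) 1"
  by (induction Js) (simp_all add: one_eq_single_Nil_Nil [symmetric] mult_single plus_list_def)

section \<open>The blocks in the gaps left by an admissible subset\<close>

context
  fixes n :: nat and L Q :: "nat set set"
  assumes L: "L \<in> NC n" and Q: "admissible L Q"
begin

text \<open>For a gap \<open>J\<close> left by \<open>Q\<close>, this is the partition J_i^{L,Q}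
  from the coproduct, not yet standardized.\<close>

definition gap_blocks :: "nat set \<Rightarrow> nat set set" where
  "gap_blocks J = {B \<in> L - Q. B \<subseteq> J}"

lemma admissible_NC_facts: "partition_on {1..n} L" "noncrossing L" "\<Union>L = {1..n}" "Q \<subseteq> L"
  using L Q by (auto simp: NC_def partition_on_def admissible_def)

lemma blocks_eqI: "B \<in> L \<Longrightarrow> C \<in> L \<Longrightarrow> x \<in> B \<Longrightarrow> x \<in> C \<Longrightarrow> B = C"
  using admissible_NC_facts(1) unfolding partition_on_def disjoint_def by blast

lemma Union_disjoint_Union: "R \<subseteq> L - Q \<Longrightarrow> \<Union>Q \<inter> \<Union>R = {}"
  using blocks_eqI admissible_NC_facts(4) by blast

lemma set_gap_list_NC: "set (gap_list {1..n} (\<Union>Q)) = gaps {1..n} (\<Union>Q)"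
  by (simp add: set_gap_list)

text \<open>Non-crossing and admissibility enter here, through \<open>residual_partition\<close>: a
  block outside \<open>Q\<close> reaching across a block of \<open>Q\<close> would have that block
  nested inside it.\<close>

lemma gap_blocks_partition:
  assumes "J \<in> gaps {1..n} (\<Union>Q)"
  shows "partition_on J (gap_blocks J)" "noncrossing (gap_blocks J)" "\<Union>(gap_blocks J) = J"
    "finite J" "J \<noteq> {}" "J \<subseteq> {1..n}"
proof -
  have "J \<in> runs (\<Union>L - \<Union>Q)" using assms by (simp only: admissible_NC_facts(3) runs_eq_gaps)
  from residual_partition [OF L Q this]
  show *: "partition_on J (gap_blocks J)" "noncrossing (gap_blocks J)"
    unfolding gap_blocks_def by blast+
  then show "\<Union>(gap_blocks J) = J" by (simp add: partition_on_def)
  show "J \<subseteq> {1..n}" using assms Union_gaps [of "{1..n}" "\<Union>Q"] by blast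
  then show "finite J" using finite_subset by blast
  show "J \<noteq> {}" using assms gaps_nonempty by metis
qed

lemma block_subset_gap:
  assumes "J \<in> gaps {1..n} (\<Union>Q)" "B \<in> L" "x \<in> B" "x \<in> J"
  shows "B \<in> gap_blocks J"
proof -
  obtain C where "C \<in> gap_blocks J" "x \<in> C" using gap_blocks_partition(3) [OF assms(1)] assms(4) by blast
  moreover from this have "B = C" using blocks_eqI assms(2,3) unfolding gap_blocks_def by blast
  ultimately show ?thesis by simp
qed

lemma Union_gap_blocks: "(\<Union>J\<in>gaps {1..n} (\<Union>Q). gap_blocks J) = L - Q"
proof (intro equalityI subsetI)
  fix B assume B: "B \<in> L - Q"
  then have "B \<noteq> {}" using admissible_NC_facts(1) by (auto simp: partition_on_def)
  then obtain x where x: "x \<in> B" by blast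
  then have "x \<in> {1..n} - \<Union>Q" using B Union_disjoint_Union [of "{B}"] admissible_NC_facts(3) by blast
  then obtain J where "J \<in> gaps {1..n} (\<Union>Q)" "x \<in> J" using Union_gaps by blast
  then show "B \<in> (\<Union>J\<in>gaps {1..n} (\<Union>Q). gap_blocks J)" using block_subset_gap B x by blast
qed (auto simp: gap_blocks_def)

lemma gap_blocks_disjoint:
  assumes "I \<in> gaps {1..n} (\<Union>Q)" "J \<in> gaps {1..n} (\<Union>Q)" "I \<noteq> J"
  shows "gap_blocks I \<inter> gap_blocks J = {}"
proof -
  have "I \<inter> J = {}" using gaps_ordered [OF assms] by blast
  moreover have "{} \<notin> gap_blocks I" using gap_blocks_partition(1) [OF assms(1)] by (simp add: partition_on_def)
  moreover have "B \<subseteq> I \<inter> J" if "B \<in> gap_blocks I \<inter> gap_blocks J" for B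
    using that unfolding gap_blocks_def by blast
  ultimately show ?thesis by fastforce
qed

text \<open>Forbidden nestings can only occur inside one gap: admissibility of \<open>Q\<close>
  excludes those that start from a block of \<open>Q\<close>, and gaps lie side by side.\<close>

lemma admissible_Un_iff:
  assumes "R \<subseteq> L - Q"
  shows "(\<forall>J\<in>gaps {1..n} (\<Union>Q). admissible (gap_blocks J) (R \<inter> gap_blocks J)) \<longleftrightarrow> admissible L (Q \<union> R)"
proof
  assume R: "\<forall>J\<in>gaps {1..n} (\<Union>Q). admissible (gap_blocks J) (R \<inter> gap_blocks J)"
  have False if B: "B \<in> Q \<union> R" and C: "C \<in> L - (Q \<union> R)" and nested: "nested B C" for B C
  proof (cases "B \<in> Q")
    case True
    then show False using Q C nested unfolding admissible_def by blast
  next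
    case False
    then have "B \<in> L - Q" "C \<in> L - Q" using B C assms by auto
    then obtain J K where J: "J \<in> gaps {1..n} (\<Union>Q)" "B \<in> gap_blocks J"
      and K: "K \<in> gaps {1..n} (\<Union>Q)" "C \<in> gap_blocks K"
      using Union_gap_blocks by blast
    have CK: "finite C" "C \<noteq> {}" "C \<subseteq> K" and BJ: "B \<noteq> {}" "B \<subseteq> J"
      using gap_blocks_partition [OF K(1)] K(2) gap_blocks_partition [OF J(1)] J(2) finite_subset
      by (auto simp: gap_blocks_def partition_on_def)
    then obtain m where m: "m \<in> B" by blast
    \<comment> \<open>Nesting places \<open>m\<close> strictly between two points of
      \<open>C\<close>, hence of the gap \<open>K\<close>; a gap entirely to the left or to the
      right of \<open>K\<close> contains no such point.\<close>
    then obtain c c' where c: "c \<in> C" "c' \<in> C" "c < m" "m < c'"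
      using nested nested_iff [OF CK(1,2), of B] by blast
    have "J = K"
    proof (rule ccontr)
      assume "J \<noteq> K"
      with gaps_ordered [OF J(1) K(1)] have "m < c \<or> c' < m" using m c(1,2) BJ(2) CK(3) by blast
      then show False using c(3,4) by simp
    qed
    moreover have "B \<in> R \<inter> gap_blocks J" "C \<notin> R" using J(2) B C False by auto
    ultimately show False
      using R [rule_format, OF J(1)] K(2) nested unfolding admissible_def by blast
  qed
  then show "admissible L (Q \<union> R)"
    using assms admissible_NC_facts(4) unfolding admissible_def by blast
next
  assume "admissible L (Q \<union> R)"
  then show "\<forall>J\<in>gaps {1..n} (\<Union>Q). admissible (gap_blocks J) (R \<inter> gap_blocks J)"
    unfolding admissible_def gap_blocks_def by blast
qed

text \<open>The gaps of \<open>Q\<close> in the union of \<open>Q\<close> and \<open>R\<close> are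
  the nonempty traces of the gaps in [n]. A gap where \<open>R\<close> picks nothing is absorbed
  because \<open>st_word {}\<close> is the empty word.\<close>

lemma residual_Un_left:
  assumes R: "R \<subseteq> L - Q"
  shows "residual (Q \<union> R) Q =
    concat (map (\<lambda>J. st_word (R \<inter> gap_blocks J)) (gap_list {1..n} (\<Union>Q)))"
proof -
  have sub: "\<Union>Q \<subseteq> {1..n}" "\<Union>R \<subseteq> {1..n}" using R admissible_NC_facts(3,4) by auto
  have "(if J \<inter> \<Union>R = {} then [] else [Abs_ncp (st_partition {B \<in> Q \<union> R - Q. B \<subseteq> J \<inter> \<Union>R})]) =
      st_word (R \<inter> gap_blocks J)" if J: "J \<in> gaps {1..n} (\<Union>Q)" for J
  proof -
    have eq: "{B \<in> Q \<union> R - Q. B \<subseteq> J \<inter> \<Union>R} = R \<inter> gap_blocks J"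
      using R unfolding gap_blocks_def by blast
    have ne: "{} \<notin> R" using R admissible_NC_facts(1) by (auto simp: partition_on_def)
    \<comment> \<open>A block meeting \<open>J\<close> lies inside \<open>J\<close>, and no block is
      empty, so \<open>R\<close> meets \<open>J\<close> in points exactly when it has a block
      there.\<close>
    have "J \<inter> \<Union>R = {} \<longleftrightarrow> R \<inter> gap_blocks J = {}"
    proof
      assume *: "R \<inter> gap_blocks J = {}"
      have "x \<notin> J" if "x \<in> B" "B \<in> R" for x B using block_subset_gap [OF J, of B x] * that R by blast
      then show "J \<inter> \<Union>R = {}" by blast
    next
      assume *: "J \<inter> \<Union>R = {}"
      have False if "B \<in> R" "B \<subseteq> J" for B
      proof -
        have "B \<subseteq> J \<inter> \<Union>R" using that by blast
        then show False using * ne that by auto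
      qed
      then show "R \<inter> gap_blocks J = {}" unfolding gap_blocks_def by blast
    qed
    then show ?thesis unfolding eq st_word_def by simp
  qed
  then have "concat (map (\<lambda>J. if J \<inter> \<Union>R = {} then []
      else [Abs_ncp (st_partition {B \<in> Q \<union> R - Q. B \<subseteq> J \<inter> \<Union>R})]) (gap_list {1..n} (\<Union>Q))) =
    concat (map (\<lambda>J. st_word (R \<inter> gap_blocks J)) (gap_list {1..n} (\<Union>Q)))"
    using set_gap_list_NC by (intro arg_cong [of _ _ concat] map_cong refl) blast
  moreover have "map f (concat (map (\<lambda>J. if J \<inter> \<Union>R = {} then [] else [J \<inter> \<Union>R]) Js)) =
      concat (map (\<lambda>J. if J \<inter> \<Union>R = {} then [] else [f (J \<inter> \<Union>R)]) Js)"
    for f :: "nat set \<Rightarrow> ncp" and Js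
    by (induction Js) simp_all
  ultimately show ?thesis
    unfolding residual_def Union_Un_distrib
    by (simp only: gap_list_sub [OF finite_atLeastAtMost sub Union_disjoint_Union [OF R]])
qed

text \<open>Two-stage cutting: first by \<open>Q\<close>, then inside each gap by the blocks of
  \<open>R\<close> lying there.\<close>

lemma residual_Un_right:
  assumes R: "R \<subseteq> L - Q"
  shows "residual L (Q \<union> R) =
    concat (map (\<lambda>J. residual (gap_blocks J) (R \<inter> gap_blocks J)) (gap_list {1..n} (\<Union>Q)))"
proof -
  have sub: "\<Union>Q \<subseteq> {1..n}" "\<Union>R \<subseteq> {1..n}" using R admissible_NC_facts(3,4) by auto
  have "map (\<lambda>K. Abs_ncp (st_partition {B \<in> L - (Q \<union> R). B \<subseteq> K})) (gap_list J (\<Union>R \<inter> J)) =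
      residual (gap_blocks J) (R \<inter> gap_blocks J)" if J: "J \<in> gaps {1..n} (\<Union>Q)" for J
  proof -
    have "\<Union>(R \<inter> gap_blocks J) = \<Union>R \<inter> J"
      using block_subset_gap [OF J] R unfolding gap_blocks_def by blast
    moreover have "{B \<in> L - (Q \<union> R). B \<subseteq> K} = {B \<in> gap_blocks J - (R \<inter> gap_blocks J). B \<subseteq> K}"
      if "K \<in> set (gap_list J (\<Union>R \<inter> J))" for K
    proof -
      have "K \<subseteq> J"
        using that Union_gaps [of J "\<Union>R \<inter> J"] set_gap_list [OF gap_blocks_partition(4) [OF J]] by blast
      then show ?thesis unfolding gap_blocks_def by blast
    qed
    ultimately show ?thesis
      unfolding residual_def gap_blocks_partition(3) [OF J] by simp
  qed
  then have "map (\<lambda>J. map (\<lambda>K. Abs_ncp (st_partition {B \<in> L - (Q \<union> R). B \<subseteq> K})) (gap_list J (\<Union>R \<inter> J)))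
      (gap_list {1..n} (\<Union>Q)) =
    map (\<lambda>J. residual (gap_blocks J) (R \<inter> gap_blocks J)) (gap_list {1..n} (\<Union>Q))"
    using set_gap_list_NC by (intro map_cong refl) blast
  then show ?thesis
    unfolding residual_def [of L] admissible_NC_facts(3) Union_Un_distrib
      gap_list_Un [OF finite_atLeastAtMost sub Union_disjoint_Union [OF R]]
    by (simp only: map_concat map_map comp_def)
qed

text \<open>The product over the gaps of their separate coproducts expands into a sum over all
  choices of one admissible set for each gap; their union \<open>R\<close> is what is added to
  \<open>Q\<close> to reach the larger member of the chain.\<close>

lemma nc_coproduct_word_residual:
  "nc_coproduct_word (residual L Q) =
    (\<Sum>R | R \<subseteq> L - Q \<and> admissible L (Q \<union> R). single (residual (Q \<union> R) Q, residual L (Q \<union> R)) (1 :: 'k::field))"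
proof -
  let ?Js = "gap_list {1..n} (\<Union>Q)"
  have "nc_coproduct_basis (Abs_ncp (st_partition (gap_blocks J))) = (coproduct_sum (gap_blocks J) :: _ \<Rightarrow>\<^sub>0 'k)"
    if J: "J \<in> gaps {1..n} (\<Union>Q)" for J
  proof -
    have "gap_blocks J \<noteq> {}" using gap_blocks_partition(3,5) [OF J] by auto
    then show ?thesis
      using nc_coproduct_word_st_word [OF gap_blocks_partition(4,1,2) [OF J]]
      by (simp add: st_word_def nc_coproduct_word_eq_prod)
  qed
  then have "map (\<lambda>J. nc_coproduct_basis (Abs_ncp (st_partition (gap_blocks J)))) ?Js =
      map (\<lambda>J. coproduct_sum (gap_blocks J) :: _ \<Rightarrow>\<^sub>0 'k) ?Js"
    using set_gap_list_NC by (intro map_cong refl) blast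
  then have "nc_coproduct_word (residual L Q) = (\<Prod>J\<leftarrow>?Js. coproduct_sum (gap_blocks J) :: _ \<Rightarrow>\<^sub>0 'k)"
    unfolding nc_coproduct_word_eq_prod residual_def admissible_NC_facts(3) gap_blocks_def [symmetric]
    by (simp only: map_map comp_def)
  also have "\<dots> = (\<Prod>J\<leftarrow>?Js. \<Sum>R\<in>{R. admissible (gap_blocks J) R}.
      single (st_word R, residual (gap_blocks J) R) 1)"
    unfolding coproduct_sum_def ..
  also have "\<dots> = (\<Sum>R | R \<subseteq> (\<Union>J\<in>set ?Js. gap_blocks J) \<and>
        (\<forall>J\<in>set ?Js. R \<inter> gap_blocks J \<in> {R. admissible (gap_blocks J) R}).
      \<Prod>J\<leftarrow>?Js. single (st_word (R \<inter> gap_blocks J), residual (gap_blocks J) (R \<inter> gap_blocks J)) 1)"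
  proof (rule prod_list_sum_expand)
    show "distinct ?Js" by (simp add: distinct_gap_list)
    show "{R. admissible (gap_blocks J) R} \<subseteq> Pow (gap_blocks J)" for J by (auto simp: admissible_def)
    show "gap_blocks I \<inter> gap_blocks J = {}" if "I \<in> set ?Js" "J \<in> set ?Js" "I \<noteq> J" for I J
      using that gap_blocks_disjoint unfolding set_gap_list_NC by blast
  qed
  also have "\<dots> = (\<Sum>R | R \<subseteq> L - Q \<and> admissible L (Q \<union> R).
      single (residual (Q \<union> R) Q, residual L (Q \<union> R)) 1)"
    unfolding set_gap_list_NC Union_gap_blocks mem_Collect_eq prod_list_single_pair
  proof (rule sum.cong)
    show "{R. R \<subseteq> L - Q \<and> (\<forall>J\<in>gaps {1..n} (\<Union>Q). admissible (gap_blocks J) (R \<inter> gap_blocks J))} =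
        {R. R \<subseteq> L - Q \<and> admissible L (Q \<union> R)}"
      using admissible_Un_iff by blast
  qed (simp add: residual_Un_left residual_Un_right)
  finally show ?thesis .
qed

end

section \<open>Chains of admissible subsets\<close>

lemma admissible_imp_noncrossing_partition:
  assumes "L \<in> NC n" "admissible L Q"
  shows "partition_on (\<Union>Q) Q" "noncrossing Q" "finite (\<Union>Q)"
proof -
  have Q: "Q \<subseteq> L" using assms(2) by (simp add: admissible_def)
  have L: "disjoint L" "{} \<notin> L" "\<Union>L = {1..n}" "noncrossing L"
    using assms(1) by (simp_all add: NC_def partition_on_def)
  show "partition_on (\<Union>Q) Q"
    unfolding partition_on_def using pairwise_subset [OF L(1) Q] L(2) Q by blast
  have False if "B \<in> Q" "C \<in> Q" "B \<noteq> C" "p < q" "q < r" "r < s" "p \<in> B" "r \<in> B" "q \<in> C" "s \<in> C"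
    for B C p q r s
    using noncrossingD [OF L(4) _ _ that(3-)] that(1,2) Q by blast
  then show "noncrossing Q" unfolding noncrossing_def by blast
  have "\<Union>Q \<subseteq> {1..n}" using L(3) Q by blast
  then show "finite (\<Union>Q)" using finite_subset by blast
qed

lemma finite_admissible: "finite L \<Longrightarrow> finite {Q. admissible L Q}"
  by (rule finite_subset [of _ "Pow L"]) (auto simp: admissible_def)

lemma finite_NC: "L \<in> NC n \<Longrightarrow> finite L"
  using finite_elements [of "{1..n}" L] by (simp add: NC_def)

lemma nc_coproduct_coassoc_letter:
  "tensor_assoc (tensor_map nc_coproduct id (nc_coproduct_basis L)) =
    (tensor_map id nc_coproduct (nc_coproduct_basis L) :: _ \<Rightarrow>\<^sub>0 'k::field)"
proof -
  define P where "P = Rep_ncp L"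
  obtain n where P: "P \<in> NC n" using Rep_ncp [of L] unfolding P_def by blast
  have lin: "flinear (tensor_map (nc_coproduct :: 'k TNC \<Rightarrow> _) id)" "flinear (tensor_map id (nc_coproduct :: 'k TNC \<Rightarrow> _))"
    unfolding tensor_map_def by (rule linear_lin_ext)+
  have lin_assoc: "flinear (tensor_assoc :: ((ncp list \<times> ncp list) \<times> ncp list \<Rightarrow>\<^sub>0 'k) \<Rightarrow> _)"
    unfolding tensor_assoc_def by (rule linear_lin_ext)
  have fin: "finite {Q. admissible P Q}" by (rule finite_admissible [OF finite_NC [OF P]])
  have fin': "finite {R. admissible Q R}" if "admissible P Q" for Q
    by (rule finite_admissible) (use that finite_NC [OF P] finite_subset in \<open>auto simp: admissible_def\<close>)
  have fin'': "finite {R. R \<subseteq> P - Q \<and> admissible P (Q \<union> R)}" for Q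
    by (rule finite_subset [of _ "Pow P"]) (use finite_NC [OF P] in auto)
  have left: "tensor_assoc (tensor_map nc_coproduct id (single (st_word Q, residual P Q) (1 :: 'k))) =
      (\<Sum>R | admissible Q R. single (st_word R, residual Q R, residual P Q) 1)"
    if Q: "admissible P Q" for Q
  proof -
    have "nc_coproduct_word (st_word Q) = (coproduct_sum Q :: _ \<Rightarrow>\<^sub>0 'k)"
      using admissible_imp_noncrossing_partition [OF P Q] nc_coproduct_word_st_word by blast
    then show ?thesis
      by (simp add: tensor_map_def nc_coproduct_single coproduct_sum_def
        flinear_sum [OF linear_tensor_left] flinear_sum [OF lin_assoc])
        (simp add: tensor_assoc_def)
  qed
  have right: "tensor_map id nc_coproduct (single (st_word Q, residual P Q) (1 :: 'k)) =
      (\<Sum>R | R \<subseteq> P - Q \<and> admissible P (Q \<union> R). single (st_word Q, residual (Q \<union> R) Q, residual P (Q \<union> R)) 1)"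
    if Q: "admissible P Q" for Q
    by (simp add: tensor_map_def nc_coproduct_single nc_coproduct_word_residual [OF P Q]
        flinear_sum [OF linear_tensor_right])
  have "tensor_assoc (tensor_map nc_coproduct id (nc_coproduct_basis L)) =
      (\<Sum>Q | admissible P Q. \<Sum>R | admissible Q R. single (st_word R, residual Q R, residual P Q) (1 :: 'k))"
    unfolding nc_coproduct_basis_eq P_def [symmetric] coproduct_sum_def flinear_sum [OF lin(1)]
      flinear_sum [OF lin_assoc]
    by (rule sum.cong [OF refl]) (simp add: left)
  also have "\<dots> = (\<Sum>(Q, R)\<in>Sigma {Q. admissible P Q} (\<lambda>Q. {R. admissible Q R}).
      single (st_word R, residual Q R, residual P Q) 1)"
    by (rule sum.Sigma) (use fin fin' in auto)
  also have "\<dots> = (\<Sum>(Q, R)\<in>Sigma {Q. admissible P Q} (\<lambda>Q. {R. R \<subseteq> P - Q \<and> admissible P (Q \<union> R)}).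
      single (st_word Q, residual (Q \<union> R) Q, residual P (Q \<union> R)) 1)"
  \<comment> \<open>Both index sets describe chains of two admissible subsets: on the left by larger
    and smaller member, on the right by smaller member and increment. Admissibility is transitive: a
    block nested in one outside the smaller set would violate admissibility either in the larger set
    or in \<open>P\<close>. Conversely, the smaller set stays admissible in the larger one by
    restriction.\<close>
  proof (rule sum.reindex_bij_witness [of _ "\<lambda>(Q, R). (Q \<union> R, Q)" "\<lambda>(Q, R). (R, Q - R)"], goal_cases)
    case (1 a)
    then show ?case by (auto simp: admissible_def)
  next
    case (2 a)
    then obtain Q R where a: "a = (Q, R)" "admissible P Q" "admissible Q R" by auto
    then have "R \<union> (Q - R) = Q" unfolding admissible_def by blast
    moreover have "admissible P R" using a(2,3) unfolding admissible_def by blast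
    moreover have "Q - R \<subseteq> P - R" using a(2) unfolding admissible_def by blast
    ultimately show ?case using a by simp
  next
    case (3 b)
    then show ?case by auto
  next
    case (4 b)
    then obtain Q R where b: "b = (Q, R)" "admissible P Q" "R \<subseteq> P - Q" "admissible P (Q \<union> R)" by auto
    then have "admissible (Q \<union> R) Q" unfolding admissible_def by blast
    then show ?case using b by simp
  next
    case (5 a)
    then obtain Q R where a: "a = (Q, R)" "admissible P Q" "admissible Q R" by auto
    then have "R \<union> (Q - R) = Q" unfolding admissible_def by blast
    then show ?case using a by simp
  qed
  also have "\<dots> = (\<Sum>Q | admissible P Q. \<Sum>R | R \<subseteq> P - Q \<and> admissible P (Q \<union> R).
      single (st_word Q, residual (Q \<union> R) Q, residual P (Q \<union> R)) 1)"
    by (rule sum.Sigma [symmetric]) (use fin fin'' in auto)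
  also have "\<dots> = tensor_map id nc_coproduct (nc_coproduct_basis L)"
    unfolding nc_coproduct_basis_eq P_def [symmetric] coproduct_sum_def flinear_sum [OF lin(2)]
    by (rule sum.cong [OF refl]) (simp add: right)
  finally show ?thesis .
qed

lemma nc_coproduct_coassoc:
  "tensor_assoc (tensor_map nc_coproduct id (nc_coproduct x)) =
    (tensor_map id nc_coproduct (nc_coproduct x) :: _ \<Rightarrow>\<^sub>0 'k::field)"
proof -
  note times = nc_coproduct_times tensor_assoc_times
    tensor_map_times [of nc_coproduct id] tensor_map_times [of id nc_coproduct]
  have one: "tensor_map f g 1 = 1" if "f 1 = 1" "g 1 = 1"
    for f :: "'k TNC \<Rightarrow> ('c::monoid_add \<Rightarrow>\<^sub>0 'k)" and g :: "'k TNC \<Rightarrow> ('d::monoid_add \<Rightarrow>\<^sub>0 'k)"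
  proof -
    have "tensor_map f g (single (0, 0) 1) = f 1 \<otimes>\<^sub>t g 1"
      by (simp add: tensor_map_def)
    then show ?thesis by (simp add: that one_tensor_one zero_prod_def [symmetric])
  qed
  have "tensor_assoc (single ((0, 0), 0) 1) = (single (0, 0, 0) 1 :: ncp list \<times> ncp list \<times> ncp list \<Rightarrow>\<^sub>0 'k)"
    by (simp add: tensor_assoc_def)
  then have one_assoc: "tensor_assoc 1 = (1 :: ncp list \<times> ncp list \<times> ncp list \<Rightarrow>\<^sub>0 'k)"
    by (simp add: zero_prod_def [symmetric])
  have "(\<lambda>x. tensor_assoc (tensor_map nc_coproduct id (nc_coproduct x))) =
    (\<lambda>x. tensor_map id nc_coproduct (nc_coproduct x) :: _ \<Rightarrow>\<^sub>0 'k)"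
  proof (rule word_algebra_hom_ext)
    show "flinear (\<lambda>x :: 'k TNC. tensor_assoc (tensor_map nc_coproduct id (nc_coproduct x)))"
      unfolding tensor_map_def tensor_assoc_def
      by (intro flinear_comp [OF _ linear_lin_ext] flinear_nc_coproduct)
    show "flinear (\<lambda>x :: 'k TNC. tensor_map id nc_coproduct (nc_coproduct x))"
      unfolding tensor_map_def
      by (intro flinear_comp [OF _ linear_lin_ext] flinear_nc_coproduct)
    show "tensor_assoc (tensor_map nc_coproduct id (nc_coproduct (single [L] (1 :: 'k)))) =
        tensor_map id nc_coproduct (nc_coproduct (single [L] 1))" for L
      using nc_coproduct_coassoc_letter [of L, where 'k = 'k]
      by (simp add: nc_coproduct_single nc_coproduct_word_eq_prod)
  qed (simp_all add: times one one_assoc nc_coproduct_one)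
  then show ?thesis by (rule fun_cong)
qed

subsection \<open>Degrees and counit\<close>

lemma word_degree_append: "word_degree (v @ w) = word_degree v + word_degree w"
  by (simp add: word_degree_def)

lemma nc_degree_pos: "0 < nc_degree L"
proof -
  obtain n where "n \<in> {1..}" "Rep_ncp L \<in> NC n" using Rep_ncp [of L] by blast
  then show ?thesis using nc_degree_eq by fastforce
qed

lemma word_degree_eq_0_iff: "word_degree w = 0 \<longleftrightarrow> w = []"
  using nc_degree_pos by (cases w) (auto simp: word_degree_def)

lemma nc_degree_st_partition:
  assumes "finite S" "partition_on S P" "noncrossing P" "P \<noteq> {}"
  shows "nc_degree (Abs_ncp (st_partition P)) = card S"
  by (rule nc_degree_eq)
    (simp add: Rep_Abs_ncp_st_partition [OF assms] st_partition_NC [OF assms(1-3)])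

lemma word_degree_st_word:
  assumes "finite S" "partition_on S P" "noncrossing P"
  shows "word_degree (st_word P) = card S"
proof (cases "P = {}")
  case True
  then show ?thesis using assms(2) by (simp add: st_word_def word_degree_def partition_on_def)
next
  case False
  then show ?thesis by (simp add: st_word_def word_degree_def nc_degree_st_partition [OF assms])
qed

text \<open>The gaps are disjoint and cover the complement of the union of \<open>Q\<close>, so
  their sizes add up.\<close>

lemma word_degree_residual:
  assumes "L \<in> NC n" "admissible L Q"
  shows "word_degree (residual L Q) = card ({1..n} - \<Union>Q)"
proof -
  let ?G = "gaps {1..n} (\<Union>Q)"
  have U: "\<Union>L = {1..n}" using assms(1) by (simp add: NC_def partition_on_def)
  have "nc_degree (Abs_ncp (st_partition {B \<in> L - Q. B \<subseteq> J})) = card J" if J: "J \<in> ?G" for J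
  proof -
    note * = gap_blocks_partition [OF assms J]
    have "gap_blocks L Q J \<noteq> {}" using *(3,5) by auto
    then show ?thesis
      using nc_degree_st_partition [OF *(4,1,2)] by (simp add: gap_blocks_def [OF assms])
  qed
  then have "map (\<lambda>J. nc_degree (Abs_ncp (st_partition {B \<in> L - Q. B \<subseteq> J}))) (gap_list {1..n} (\<Union>Q)) =
      map card (gap_list {1..n} (\<Union>Q))"
    by (intro map_cong refl) (simp add: set_gap_list)
  then have "word_degree (residual L Q) = sum_list (map card (gap_list {1..n} (\<Union>Q)))"
    unfolding word_degree_def residual_def U by (simp only: map_map comp_def)
  also have "\<dots> = sum card ?G"
    by (simp add: sum_list_distinct_conv_sum_set distinct_gap_list set_gap_list)
  also have "\<dots> = card (\<Union>?G)"
  proof (rule card_Union_disjoint [symmetric])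
    show "disjoint ?G"
    proof (rule disjointI)
      fix I J assume "I \<in> ?G" "J \<in> ?G" "I \<noteq> J"
      from gaps_ordered [OF this] show "I \<inter> J = {}" by blast
    qed
  qed (rule gap_blocks_partition(4) [OF assms])
  finally show ?thesis by (simp add: Union_gaps)
qed

text \<open>For one letter, a decomposition splits [n] into the union of \<open>Q\<close> and its
  complement; multiplying coproducts concatenates in each leg and adds degrees.\<close>

lemma keys_nc_coproduct_word:
  "(a, b) \<in> keys (nc_coproduct_word w :: _ \<Rightarrow>\<^sub>0 'k::field) \<Longrightarrow> word_degree a + word_degree b = word_degree w"
proof (induction w arbitrary: a b)
  case Nil
  then show ?case
    by (simp add: nc_coproduct_word_eq_prod one_eq_single_Nil_Nil word_degree_def)
next
  case (Cons L w)
  define P where "P = Rep_ncp L"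
  obtain n where P: "P \<in> NC n" using Rep_ncp [of L] unfolding P_def by blast
  have L: "word_degree c + word_degree d = nc_degree L"
    if "(c, d) \<in> keys (nc_coproduct_basis L :: _ \<Rightarrow>\<^sub>0 'k)" for c d
  proof -
    have "(c, d) \<in> (\<Union>Q\<in>{Q. admissible P Q}. keys (single (st_word Q, residual P Q) (1 :: 'k)))"
      using that keys_sum unfolding nc_coproduct_basis_eq coproduct_sum_def P_def [symmetric] by fast
    then obtain Q where Q: "admissible P Q" "c = st_word Q" "d = residual P Q" by auto
    have "\<Union>Q \<subseteq> {1..n}" using P Q(1) unfolding NC_def partition_on_def admissible_def by blast
    then have "card (\<Union>Q) + card ({1..n} - \<Union>Q) = n"
      using card_Un_disjoint [of "\<Union>Q" "{1..n} - \<Union>Q"] finite_subset [of "\<Union>Q" "{1..n}"]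
      by (simp add: Un_absorb1)
    moreover have "nc_degree L = n" using P unfolding P_def by (rule nc_degree_eq)
    ultimately show ?thesis
      using Q word_degree_residual [OF P Q(1)] admissible_imp_noncrossing_partition [OF P Q(1)]
        word_degree_st_word [of "\<Union>Q" Q] by simp
  qed
  have "(a, b) \<in> keys (nc_coproduct_basis L * nc_coproduct_word w :: _ \<Rightarrow>\<^sub>0 'k)"
    using Cons.prems by (simp add: nc_coproduct_word_eq_prod)
  then obtain c d where cd: "(a, b) = c + d" "c \<in> keys (nc_coproduct_basis L :: _ \<Rightarrow>\<^sub>0 'k)"
    "d \<in> keys (nc_coproduct_word w :: _ \<Rightarrow>\<^sub>0 'k)"
    using keys_mult by blast
  have "word_degree (fst c) + word_degree (snd c) = nc_degree L"
    "word_degree (fst d) + word_degree (snd d) = word_degree w"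
    using L [of "fst c" "snd c"] Cons.IH [of "fst d" "snd d"] cd by simp_all
  moreover have "a = fst c @ fst d" "b = snd c @ snd d"
    using cd(1) by (simp_all add: plus_prod_def plus_list_def)
  ultimately show ?case by (simp add: word_degree_append word_degree_def)
qed

section \<open>Trivial decompositions and the counit\<close>

lemma st_word_Rep_ncp: "st_word (Rep_ncp L) = [L]"
proof -
  obtain n where n: "n \<in> {1..}" "Rep_ncp L \<in> NC n" using Rep_ncp [of L] by blast
  then have U: "\<Union>(Rep_ncp L) = {1..n}" by (simp add: NC_def partition_on_def)
  have "st {1..n} x = x" if "x \<in> {1..n}" for x
  proof -
    have "{y \<in> {1..n}. y \<le> x} = {1..x}" using that by auto
    then show ?thesis by (simp add: st_def)
  qed
  then have "st {1..n} ` B = B" if "B \<in> Rep_ncp L" for B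
  proof -
    have "st {1..n} ` B = (\<lambda>x. x) ` B"
      by (rule image_cong [OF refl]) (use that U \<open>\<And>x. x \<in> {1..n} \<Longrightarrow> st {1..n} x = x\<close> in blast)
    then show ?thesis by simp
  qed
  then have "st_partition (Rep_ncp L) = Rep_ncp L" by (simp add: st_partition_def U)
  moreover have "Rep_ncp L \<noteq> {}" using U n(1) by auto
  ultimately show ?thesis by (simp add: st_word_def Rep_ncp_inverse)
qed

lemma residual_empty: "residual (Rep_ncp L) {} = [L]"
proof -
  obtain n where n: "n \<in> {1..}" "Rep_ncp L \<in> NC n" using Rep_ncp [of L] by blast
  then have U: "\<Union>(Rep_ncp L) = {1..n}" by (simp add: NC_def partition_on_def)
  have "{B \<in> Rep_ncp L - {}. B \<subseteq> {1..n}} = Rep_ncp L" using U by auto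
  moreover have "Rep_ncp L \<noteq> {}" using U n(1) by auto
  moreover have "gap_list {1..n} {} = [{1..n}]" by (rule gap_list_empty) (use n(1) in auto)
  ultimately show ?thesis
    using st_word_Rep_ncp [of L] by (simp add: residual_def U st_word_def del: Rep_ncp_inject)
qed

text \<open>An empty residual word has degree zero, so \<open>Q\<close> covers [n]; blocks being
  nonempty and disjoint, \<open>Q\<close> then contains all of them.\<close>

lemma residual_eq_Nil_iff:
  assumes "L \<in> NC n" "admissible L Q"
  shows "residual L Q = [] \<longleftrightarrow> Q = L"
proof -
  have L: "\<Union>L = {1..n}" "Q \<subseteq> L" "{} \<notin> L" "disjoint L"
    using assms by (auto simp: NC_def partition_on_def admissible_def)
  have "residual L Q = [] \<longleftrightarrow> {1..n} - \<Union>Q = {}"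
    using word_degree_residual [OF assms] word_degree_eq_0_iff [of "residual L Q"] by simp
  also have "\<dots> \<longleftrightarrow> Q = L"
  proof
    assume *: "{1..n} - \<Union>Q = {}"
    have "B \<in> Q" if B: "B \<in> L" for B
    proof -
      have "B \<noteq> {}" using B L(3) by auto
      then obtain x where x: "x \<in> B" by blast
      then obtain C where "C \<in> Q" "x \<in> C" using * L(1) B by blast
      then have "B = C" using L(2,4) B x unfolding disjoint_def by blast
      then show ?thesis using \<open>C \<in> Q\<close> by simp
    qed
    then show "Q = L" using L(2) by blast
  qed (use L in auto)
  finally show ?thesis .
qed

text \<open>The only candidate compatible with the grading: it must vanish in positive degree and
  take the value 1 on the empty word.\<close>

definition nc_counit :: "'k::field TNC \<Rightarrow> 'k" where
  "nc_counit x = lookup x []"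

lemma nc_counit_single: "nc_counit (single w c) = (if w = [] then c else 0)"
  by (simp add: nc_counit_def lookup_single when_def)

lemma linear_nc_counit: "Vector_Spaces.linear fscale (*) nc_counit"
  by unfold_locales (simp_all add: nc_counit_def lookup_add algebra_simps)

lemma nc_counit_times: "nc_counit (x * y) = nc_counit x * nc_counit y"
proof -
  \<comment> \<open>Embedding scalars as multiples of the empty word makes the counit a linear map
    between monoid algebras, so that \<open>flinear_multiplicativeI\<close> applies.\<close>
  have "single [] (nc_counit (x * y)) = single [] (nc_counit x) * single ([] :: ncp list) (nc_counit y)"
  proof (rule flinear_multiplicativeI [of "\<lambda>x. single [] (nc_counit x)"])
    show "flinear (\<lambda>x. single ([] :: ncp list) (nc_counit x))"
      by (rule flinearI) (simp_all add: nc_counit_def lookup_add single_add)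
  qed (auto simp: nc_counit_single plus_list_def mult_single)
  then have "lookup (single ([] :: ncp list) (nc_counit (x * y))) [] =
      lookup (single ([] :: ncp list) (nc_counit x * nc_counit y)) []"
    by (simp add: mult_single plus_list_def)
  then show ?thesis by simp
qed

lemma nc_counit_left:
  "lin_ext (\<lambda>(a, b). fscale (nc_counit (single a 1)) (single b 1)) (nc_coproduct x) = (x :: 'k::field TNC)"
    (is "?E (nc_coproduct x) = x")
proof -
  have E: "?E (X * Y) = ?E X * ?E Y" for X Y :: "ncp list \<times> ncp list \<Rightarrow>\<^sub>0 'k"
    by (rule flinear_multiplicativeI [OF linear_lin_ext])
      (auto simp: nc_counit_single plus_list_def mult_single)
  have "(\<lambda>x. ?E (nc_coproduct x)) = (\<lambda>x. x)"
  proof (rule word_algebra_hom_ext [OF flinear_comp [OF flinear_nc_coproduct linear_lin_ext] flinear_id(2)])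
    show "?E (nc_coproduct 1) = 1"
      unfolding nc_coproduct_one one_eq_single_Nil_Nil
      by (simp add: nc_counit_single bar_one_eq_one [symmetric] bar_one_def)
    fix L
    define P where "P = Rep_ncp L"
    obtain n where P: "P \<in> NC n" using Rep_ncp [of L] unfolding P_def by blast
    have "?E (nc_coproduct (single [L] 1)) =
        (\<Sum>Q | admissible P Q. ?E (single (st_word Q, residual P Q) 1))"
      by (simp only: nc_coproduct_single nc_coproduct_word_eq_prod list.map prod_list.Cons prod_list.Nil
        mult_1_right nc_coproduct_basis_eq coproduct_sum_def P_def flinear_sum [OF linear_lin_ext])
    \<comment> \<open>The left leg is the empty word only for \<open>Q = {}\<close>, and then the
      right leg is \<open>L\<close> itself.\<close>
    also have "\<dots> = (\<Sum>Q | admissible P Q. if Q = {} then single [L] 1 else 0)"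
      by (rule sum.cong [OF refl]) (auto simp: nc_counit_single st_word_def P_def residual_empty)
    also have "\<dots> = single [L] 1"
    proof -
      have "admissible P {}" by (simp add: admissible_def)
      then show ?thesis using finite_admissible [OF finite_NC [OF P]] by (simp add: sum.delta)
    qed
    finally show "?E (nc_coproduct (single [L] 1)) = single [L] 1" .
    show "?E (nc_coproduct (x * y)) = ?E (nc_coproduct x) * ?E (nc_coproduct y)" for x y
      by (simp only: nc_coproduct_times E)
  qed simp
  then show ?thesis by (rule fun_cong)
qed

lemma nc_counit_right:
  "lin_ext (\<lambda>(a, b). fscale (nc_counit (single b 1)) (single a 1)) (nc_coproduct x) = (x :: 'k::field TNC)"
    (is "?E (nc_coproduct x) = x")
proof -
  have E: "?E (X * Y) = ?E X * ?E Y" for X Y :: "ncp list \<times> ncp list \<Rightarrow>\<^sub>0 'k"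
    by (rule flinear_multiplicativeI [OF linear_lin_ext])
      (auto simp: nc_counit_single plus_list_def mult_single)
  have "(\<lambda>x. ?E (nc_coproduct x)) = (\<lambda>x. x)"
  proof (rule word_algebra_hom_ext [OF flinear_comp [OF flinear_nc_coproduct linear_lin_ext] flinear_id(2)])
    show "?E (nc_coproduct 1) = 1"
      unfolding nc_coproduct_one one_eq_single_Nil_Nil
      by (simp add: nc_counit_single bar_one_eq_one [symmetric] bar_one_def)
    fix L
    define P where "P = Rep_ncp L"
    obtain n where P: "P \<in> NC n" using Rep_ncp [of L] unfolding P_def by blast
    have "?E (nc_coproduct (single [L] 1)) =
        (\<Sum>Q | admissible P Q. ?E (single (st_word Q, residual P Q) 1))"
      by (simp only: nc_coproduct_single nc_coproduct_word_eq_prod list.map prod_list.Cons prod_list.Nil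
        mult_1_right nc_coproduct_basis_eq coproduct_sum_def P_def flinear_sum [OF linear_lin_ext])
    \<comment> \<open>The right leg is the empty word only when nothing is left over, that is for
      \<open>Q = P\<close>, and then the left leg is \<open>L\<close>.\<close>
    also have "\<dots> = (\<Sum>Q | admissible P Q. if Q = P then single [L] 1 else 0)"
    proof (rule sum.cong [OF refl], clarsimp)
      fix Q assume Q: "admissible P Q"
      show "(Q = P \<longrightarrow> single (st_word P) (nc_counit (single (residual P P) 1)) = single [L] (1 :: 'k)) \<and>
          (Q \<noteq> P \<longrightarrow> single (st_word Q) (nc_counit (single (residual P Q) (1 :: 'k))) = 0)"
        using residual_eq_Nil_iff [OF P Q] st_word_Rep_ncp [of L]
        by (auto simp: nc_counit_single P_def [symmetric])
    qed
    also have "\<dots> = single [L] 1"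
    proof -
      have "admissible P P" by (simp add: admissible_def)
      then show ?thesis using finite_admissible [OF finite_NC [OF P]] by (simp add: sum.delta)
    qed
    finally show "?E (nc_coproduct (single [L] 1)) = single [L] 1" .
    show "?E (nc_coproduct (x * y)) = ?E (nc_coproduct x) * ?E (nc_coproduct y)" for x y
      by (simp only: nc_coproduct_times E)
  qed simp
  then show ?thesis by (rule fun_cong)
qed

section \<open>Assembly of the connected graded Hopf algebra\<close>

lemma bialgebra_nc: "bialgebra (bar_mult :: 'k::field TNC \<Rightarrow> _) bar_one nc_coproduct nc_counit"
  unfolding bar_mult_eq_times bar_one_eq_one
proof (intro bialgebra.intro unital_algebra.intro counital_coalgebra.intro bialgebra_axioms.intro)
  show "nc_coproduct 1 = (1 :: 'k TNC) \<otimes>\<^sub>t (1 :: 'k TNC)"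
    by (simp add: nc_coproduct_one one_tensor_one)
  show "lin_ext (\<lambda>(a, b). fscale (nc_counit (single a 1)) (single b 1)) (nc_coproduct x) = x"
    "lin_ext (\<lambda>(a, b). fscale (nc_counit (single b 1)) (single a 1)) (nc_coproduct x) = x" for x :: "'k TNC"
    by (rule nc_counit_left nc_counit_right)+
  show "nc_counit (1 :: 'k TNC) = 1"
    by (simp add: bar_one_eq_one [symmetric] bar_one_def nc_counit_single)
qed (simp_all add: flinear_times_left flinear_times_right mult.assoc flinear_nc_coproduct
  linear_nc_counit nc_coproduct_coassoc nc_coproduct_times
  tensor_mult_times nc_counit_times)

lemma connected_graded_hopf_algebra_nc:
  "\<exists>antipode. connected_graded_hopf_algebra (bar_mult :: 'k::field TNC \<Rightarrow> _) bar_one nc_coproduct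
    nc_counit antipode nc_component"
proof -
  have "nc_component = (\<lambda>n. pm.span {single w (1 :: 'k) |w. word_degree w = n})"
    by (rule ext) (simp add: nc_component_def)
  moreover have "\<exists>antipode. connected_graded_hopf_algebra (bar_mult :: 'k TNC \<Rightarrow> _) bar_one
    nc_coproduct nc_counit antipode (\<lambda>n. pm.span {single w 1 |w. word_degree w = n})"
  proof (rule bialgebra.connected_graded_bialgebra_has_antipode [OF bialgebra_nc])
    show "bar_one = single [] (1 :: 'k)" by (rule bar_one_def)
    show "bar_mult (single v 1) (single w (1 :: 'k)) \<in>
        pm.span {single u 1 |u. word_degree u = word_degree v + word_degree w}" for v w
      by (simp add: bar_mult_eq_times mult_single span_singles plus_list_def word_degree_append)
  qed (simp_all add: word_degree_eq_0_iff nc_counit_single nc_coproduct_single keys_nc_coproduct_word)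
  ultimately show ?thesis by simp
qed

subsection \<open>Noncommutativity and noncocommutativity\<close>

lemma lookup_tensor_swap: "lookup (tensor_swap X) (b, a) = lookup X (a, b)"
proof -
  have "lookup (tensor_swap X) (b, a) = (\<Sum>p\<in>keys X. if p = (a, b) then lookup X p else 0)"
    unfolding tensor_swap_def lin_ext_def lookup_sum
    by (intro sum.cong refl) (auto simp: lookup_single when_def split: if_splits)
  also have "\<dots> = lookup X (a, b)" by (simp add: in_keys_iff)
  finally show ?thesis .
qed

lemma not_commutative_bar_mult: "\<not> commutative_algebra (bar_mult :: 'k::field TNC \<Rightarrow> _)"
proof
  assume "commutative_algebra (bar_mult :: 'k TNC \<Rightarrow> _)"
  \<comment> \<open>Any two distinct letters do: the words \<open>[K, L]\<close> and
    \<open>[L, K]\<close> are then different basis elements.\<close>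
  have "{{1}} \<in> NC 1" "{{1, 2}} \<in> NC 2"
    by (auto simp: NC_def noncrossing_def partition_on_def)
  note Rep = this [THEN Rep_Abs_ncp]
  have "Abs_ncp {{1}} \<noteq> Abs_ncp {{1, 2}}"
  proof
    assume "Abs_ncp {{1}} = Abs_ncp {{1, 2}}"
    then have "{{1 :: nat}} = {{1, 2}}" using Rep by simp
    then show False by (simp add: doubleton_eq_iff)
  qed
  then obtain K L :: ncp where KL: "K \<noteq> L" by blast
  have "bar_mult (single [K] 1) (single [L] (1 :: 'k)) = bar_mult (single [L] 1) (single [K] 1)"
    using \<open>commutative_algebra _\<close> unfolding commutative_algebra_def by blast
  then have "single [K, L] (1 :: 'k) = single [L, K] 1"
    by (simp add: bar_mult_eq_times mult_single plus_list_def)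
  then have "lookup (single [K, L] (1 :: 'k)) [K, L] = lookup (single [L, K] 1) [K, L]" by simp
  then show False using KL by (simp add: lookup_single when_def split: if_splits)
qed

text \<open>
  The witness is \<open>L = {{1, 3}, {2}}\<close>: its coproduct contains \<open>{{1, 2}} \<otimes> {{1}}\<close>, of bidegree \<open>(2, 1)\<close>,
  but no term of bidegree \<open>(1, 2)\<close>, because \<open>{2}\<close> is nested in \<open>{1, 3}\<close>.
\<close>

lemma not_cocommutative_nc_coproduct:
  "\<not> cocommutative_coalgebra (nc_coproduct :: 'k::field_char_0 TNC \<Rightarrow> _)"
proof
  assume cocomm: "cocommutative_coalgebra (nc_coproduct :: 'k TNC \<Rightarrow> _)"
  define P :: "nat set set" where "P = {{1, 3}, {2}}"
  define Q :: "nat set set" where "Q = {{1, 3}}"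
  have P: "P \<in> NC 3"
  proof -
    have "partition_on {1..3} P"
      unfolding P_def partition_on_def disjoint_def by auto
    moreover have "noncrossing P" unfolding P_def noncrossing_def by auto
    ultimately show ?thesis by (simp add: NC_def)
  qed
  then have Rep: "Rep_ncp (Abs_ncp P) = P" by (rule Rep_Abs_ncp) simp
  have nested: "nested {2} {1, 3}" "\<not> nested {1, 3} {2}"
    by (simp_all add: nested_iff)
  have Q: "admissible P Q"
    using nested by (auto simp: admissible_def P_def Q_def)
  define X where "X = (nc_coproduct (single [Abs_ncp P] 1) :: _ \<Rightarrow>\<^sub>0 'k)"
  have X: "X = (\<Sum>R | admissible P R. single (st_word R, residual P R) 1)"
    unfolding X_def by (simp add: nc_coproduct_single nc_coproduct_word_eq_prod nc_coproduct_basis_eq Rep coproduct_sum_def)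
  let ?a = "st_word Q" and ?b = "residual P Q"
  have fin: "finite {R. admissible P R}" by (rule finite_admissible [OF finite_NC [OF P]])
  \<comment> \<open>The coefficient counts the decompositions producing this pair. In characteristic
    zero a nonzero count is a nonzero scalar, so exhibiting \<open>Q\<close> is enough.\<close>
  have "lookup X (?a, ?b) = of_nat (card {R \<in> {R. admissible P R}. st_word R = ?a \<and> residual P R = ?b})"
    unfolding X lookup_sum by (simp add: lookup_single when_def sum.If_cases fin Int_def)
  moreover have "card {R \<in> {R. admissible P R}. st_word R = ?a \<and> residual P R = ?b} \<noteq> 0"
    using fin Q by auto
  ultimately have ab: "lookup X (?a, ?b) \<noteq> 0" by simp
  \<comment> \<open>The word \<open>?b\<close> has degree 1, so \<open>R\<close> would have to cover
    a single point and hence be \<open>{{2}}\<close>, which is not admissible.\<close>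
  have "st_word R \<noteq> ?b" if R: "admissible P R" for R
  proof
    assume "st_word R = ?b"
    then have "card (\<Union>R) = card ({1..3} - \<Union>Q)"
      using word_degree_residual [OF P Q] word_degree_st_word [OF admissible_imp_noncrossing_partition(3,1,2) [OF P R]] by simp
    moreover have "{1..3} - \<Union>Q = {2}" by (auto simp: Q_def)
    ultimately have "card (\<Union>R) = 1" by simp
    moreover have "R \<in> {{}, {{1, 3}}, {{2}}, {{1, 3}, {2}}}"
      using R unfolding admissible_def P_def by blast
    ultimately have "R = {{2}}" by (auto simp: card_insert_if)
    then have "{2} \<in> R" "{1, 3} \<in> P - R" by (auto simp: P_def)
    then show False using R nested(1) unfolding admissible_def by blast
  qed
  then have "lookup X (?b, ?a) = 0"
    unfolding X lookup_sum by (intro sum.neutral) (simp add: lookup_single when_def)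
  moreover have "tensor_swap X = X" using cocomm unfolding X_def cocommutative_coalgebra_def by blast
  ultimately show False using ab lookup_tensor_swap [of X ?b ?a] by simp
qed

theorem mainTheorem1:
  shows "(\<exists>counit antipode. connected_graded_hopf_algebra
            (bar_mult :: 'k::field_char_0 TNC \<Rightarrow> 'k TNC \<Rightarrow> 'k TNC) bar_one nc_coproduct
            counit antipode nc_component)
         \<and> \<not> commutative_algebra (bar_mult :: 'k TNC \<Rightarrow> 'k TNC \<Rightarrow> 'k TNC)
         \<and> \<not> cocommutative_coalgebra (nc_coproduct :: 'k TNC \<Rightarrow> (ncp list \<times> ncp list \<Rightarrow>\<^sub>0 'k))"
  using connected_graded_hopf_algebra_nc not_commutative_bar_mult not_cocommutative_nc_coproduct by blast

end
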